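(* Let $d\ge2$ and $m\ge1$ be integers and suppose $A\subseteq\mathbb{Z}^m$ is $d$-sparse. If $A$ is stable in $(\mathbb{Z}^m,+)$, then $A$ is a finite Boolean combination of translates of finite sums of sets of the form $C(a;\delta)=\{a+d^\delta a+\cdots+d^{n\delta}a : n\in\mathbb{N}\}$, where $a\in\mathbb{Z}^m$ and $\delta$ is a positive integer.
   Context: For a finite string $k_0\cdots k_n$ of integers, $[k_0\cdots k_n]=\sum_i k_id^i$ (least significant digit first); for strings whose letters are column vectors in $\mathbb{Z}^m$, $[\cdot]$ is applied to each row, giving an element of $\mathbb{Z}^m$. Let $\Sigma=\{0,\ldots,d-1\}$ and $\Sigma_\pm=\{-d+1,\ldots,d-1\}$. Canonical representation base $d$: of $0$ the empty word; of $a>0$ its usual base-$d$ digit string in $\Sigma^*$ written least significant digit first; of $a<0$ the word $(-k_0)\cdots(-k_n)$ where $k_0\cdots k_n$ is the canonical representation of $-a$; of $(a_1,\ldots,a_m)\in\mathbb{Z}^m$ the word over the alphabet $\Sigma_\pm^m$ whose $i$-th row is the canonical representation of $a_i$ padded with trailing zeros to the maximum length of the canonical representations of the $a_j$. A language $L$ over a finite alphabet is sparse if it is regular and the number of words of $L$ of length $\le k$ is bounded by a polynomial in $k$. $A\subseteq\mathbb{Z}^m$ is $d$-sparse if the set of canonical representations of its elements is a sparse language over $\Sigma_\pm^m$. An $N$-ladder for $R\subseteq X\times X$ is $a_0,\ldots,a_N,b_0,\ldots,b_N$ with $(a_i,b_j)\in R$ iff $i\le j$; $R$ is stable if some $N$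 admits no $N$-ladder. $A$ is stable in $(\mathbb{Z}^m,+)$ if $\{(x,y)\in(\mathbb{Z}^m)^2:x+y\in A\}$ is stable. *)

theory Defs
  imports
    "HOL-Analysis.Finite_Cartesian_Product"
    "HOL-Computational_Algebra.Polynomial"
    "HOL-Library.Set_Algebras"
    "HOL-Library.More_List"
begin

text \<open>
  The group of integer vectors of length \<open>m\<close> is the type \<open>int ^ 'm\<close> with \<open>'m :: finite\<close>;
  since types are nonempty, \<open>m = CARD('m) \<ge> 1\<close> holds automatically.
\<close>


subsection \<open>Regular and sparse languages\<close>

text \<open>
  Recognisability by a complete deterministic finite automaton. Taking the states to be natural
  numbers is no restriction, because the state set is finite.
\<close>

definition regular_language :: "'a set \<Rightarrow> 'a list set \<Rightarrow> bool" where
  "regular_language \<Sigma> L \<longleftrightarrow>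
     (\<exists>(Q :: nat set) q0 \<delta> F.
        finite Q \<and> q0 \<in> Q \<and> F \<subseteq> Q \<and> (\<forall>q\<in>Q. \<forall>s\<in>\<Sigma>. \<delta> q s \<in> Q) \<and>
        L = {w \<in> lists \<Sigma>. foldl \<delta> q0 w \<in> F})"

definition sparse_language :: "'a set \<Rightarrow> 'a list set \<Rightarrow> bool" where
  "sparse_language \<Sigma> L \<longleftrightarrow>
     finite \<Sigma> \<and> regular_language \<Sigma> L \<and>
     (\<exists>p :: real poly. \<forall>k :: nat. real (card {w \<in> L. length w \<le> k}) \<le> poly p (real k))"


subsection \<open>Canonical representations\<close>

text \<open>
  Digit strings are written least significant digit first. The disjunct \<open>d < 2\<close> only serves to make
  the recursion total.
\<close>

function nat_digits :: "nat \<Rightarrow> nat \<Rightarrow> nat list" where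
  "nat_digits d n = (if d < 2 \<or> n = 0 then [] else (n mod d) # nat_digits d (n div d))"
  by pat_completeness auto
termination
  by (relation "measure snd") auto

declare nat_digits.simps [simp del]

definition int_canonical :: "nat \<Rightarrow> int \<Rightarrow> int list" where
  "int_canonical d a = map (\<lambda>k. sgn a * int k) (nat_digits d (nat \<bar>a\<bar>))"

definition vec_canonical :: "nat \<Rightarrow> int ^ 'm \<Rightarrow> (int ^ 'm) list" where
  "vec_canonical d a =
     map (\<lambda>j. \<chi> i. nth_default 0 (int_canonical d (a $ i)) j)
       [0..<Max (range (\<lambda>i. length (int_canonical d (a $ i))))]"

definition signed_alphabet :: "nat \<Rightarrow> (int ^ 'm) set" where
  "signed_alphabet d = {v. \<forall>i. v $ i \<in> {- int d + 1..int d - 1}}"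

definition d_sparse :: "nat \<Rightarrow> (int ^ 'm) set \<Rightarrow> bool" where
  "d_sparse d A \<longleftrightarrow> sparse_language (signed_alphabet d) (vec_canonical d ` A)"


subsection \<open>Stability\<close>

definition is_ladder :: "nat \<Rightarrow> ('a \<times> 'a) set \<Rightarrow> (nat \<Rightarrow> 'a) \<Rightarrow> (nat \<Rightarrow> 'a) \<Rightarrow> bool" where
  "is_ladder N R a b \<longleftrightarrow> (\<forall>i\<le>N. \<forall>j\<le>N. (a i, b j) \<in> R \<longleftrightarrow> i \<le> j)"

definition stable_relation :: "('a \<times> 'a) set \<Rightarrow> bool" where
  "stable_relation R \<longleftrightarrow> (\<exists>N. \<not> (\<exists>a b. is_ladder N R a b))"

definition stable_in_group :: "'a :: ab_group_add set \<Rightarrow> bool" where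
  "stable_in_group A \<longleftrightarrow> stable_relation {(x, y). x + y \<in> A}"


subsection \<open>Boolean combinations of translates of sums of the sets \<open>C(a;\<delta>)\<close>\<close>

definition C_set :: "nat \<Rightarrow> int ^ 'm \<Rightarrow> nat \<Rightarrow> (int ^ 'm) set" where
  "C_set d a \<delta> = {(\<Sum>i\<le>n. (int d ^ (i * \<delta>)) *s a) | n :: nat. True}"

text \<open>
  The sum of sets below is the Minkowski sum. The empty sum is \<open>{0} = C(0;\<delta>)\<close>, so admitting
  \<open>r = 0\<close> adds no new sets.
\<close>

definition translated_C_sums :: "nat \<Rightarrow> (int ^ 'm) set set" where
  "translated_C_sums d =
     {(+) c ` (\<Sum>i<r. C_set d (a i) (\<delta> i)) | c (r :: nat) a \<delta>. \<forall>i<r. \<delta> i > 0}"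

inductive_set boolean_combinations :: "'a set set \<Rightarrow> 'a set set" for \<F> :: "'a set set" where
  base: "X \<in> \<F> \<Longrightarrow> X \<in> boolean_combinations \<F>"
| compl: "X \<in> boolean_combinations \<F> \<Longrightarrow> - X \<in> boolean_combinations \<F>"
| union: "X \<in> boolean_combinations \<F> \<Longrightarrow> Y \<in> boolean_combinations \<F> \<Longrightarrow>
    X \<union> Y \<in> boolean_combinations \<F>"
| inter: "X \<in> boolean_combinations \<F> \<Longrightarrow> Y \<in> boolean_combinations \<F> \<Longrightarrow>
    X \<inter> Y \<in> boolean_combinations \<F>"

end

theory Submission
  imports Defs
begin

text \<open>
  Pumping in a sparse regular language shows that, for a suitable power \<open>q\<close> of \<open>d\<close>, the set \<open>A\<close> is a
  finite union of ordered sets \<open>{c + \<Sum>i<r. (1 + q + \<dots> + q^e i) *s a i | e 0 > \<dots> > e (r - 1)}\<close>; dropping the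
  order constraint gives a translate of a sum of sets \<open>C(a;\<delta>)\<close>. If an equation between two such sums has
  a large gap in its exponents, then by size and divisibility the parts above the gap agree, so they can
  be shifted independently of the rest. Hence whether a sum with widely separated exponents
  belongs to \<open>A\<close> depends only on the order of its exponents. If swapping two neighbouring exponents
  changed the membership, then moving these two alone would yield arbitrarily long ladders; so for stable \<open>A\<close>
  the order does not matter either, and the same holds for the unordered sets themselves. An unordered set
  \<open>V\<close> of rank \<open>r\<close> therefore has either all or none of its sums with widely separated
  exponents in \<open>A\<close>. The other elements of \<open>V\<close> lie in finitely many unordered sets of rank
  \<open>r - 1\<close>, and induction on the rank applies to \<open>V - A\<close> or to \<open>A \<inter> V\<close>.
\<close>

section \<open>Geometric sums and the sets they generate\<close>

interpretation ivec: module "(*s) :: int \<Rightarrow> int ^ 'm \<Rightarrow> int ^ 'm"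
  by unfold_locales (vector algebra_simps)+

text \<open>With \<open>q = d ^ \<delta>\<close> the vectors \<open>geo q n *s a\<close> are the
  elements of C(a;\<delta>).\<close>

definition geo :: "int \<Rightarrow> nat \<Rightarrow> int" where
  "geo q e = (\<Sum>k\<le>e. q ^ k)"

lemma geo_closed_form: "(q - 1) * geo q e = q ^ Suc e - 1"
  unfolding geo_def by (induction e) (simp_all add: algebra_simps)

lemma geo_0 [simp]: "geo q 0 = 1"
  by (simp add: geo_def)

lemma geo_Suc_add:
  assumes "q \<noteq> 1"
  shows "geo q (e + Suc k) = geo q k + q ^ Suc k * geo q e"
proof -
  have "(q - 1) * geo q (e + Suc k) = (q - 1) * (geo q k + q ^ Suc k * geo q e)"
    unfolding distrib_left mult.left_commute[of "q - 1" "q ^ Suc k"] geo_closed_form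
    by (simp add: algebra_simps power_add)
  then show ?thesis using assms by simp
qed

definition geo_comb :: "int \<Rightarrow> nat set \<Rightarrow> (nat \<Rightarrow> int ^ 'm) \<Rightarrow> (nat \<Rightarrow> nat) \<Rightarrow> int ^ 'm" where
  "geo_comb q I b e = (\<Sum>i\<in>I. geo q (e i) *s b i)"

text \<open>The relation \<open>R\<close> prescribes comparisons between exponents, so that one
  argument about representations covers the ordered sets and, with the empty relation, the unordered
  ones.\<close>

definition geo_set ::
  "int \<Rightarrow> (nat \<Rightarrow> nat \<Rightarrow> bool) \<Rightarrow> nat set \<Rightarrow> int ^ 'm \<Rightarrow> (nat \<Rightarrow> int ^ 'm) \<Rightarrow> (int ^ 'm) set" where
  "geo_set q R I c b = {c + geo_comb q I b e | e. \<forall>i\<in>I. \<forall>j\<in>I. R i j \<longrightarrow> e j < e i}"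

text \<open>The exponents of an ordered set decrease with the index, so that a new smallest exponent can be
  appended at index \<open>r\<close>.\<close>

abbreviation free_geo_set where
  "free_geo_set q \<equiv> geo_set q (\<lambda>_ _. False)"

abbreviation descending_geo_set where
  "descending_geo_set q r \<equiv> geo_set q (<) {..<r}"

lemma geo_comb_cong:
  "\<lbrakk>\<And>i. i \<in> I \<Longrightarrow> e i = e' i; \<And>i. i \<in> I \<Longrightarrow> b i = b' i\<rbrakk> \<Longrightarrow> geo_comb q I b e = geo_comb q I b' e'"
  by (simp add: geo_comb_def)

subsection \<open>Splitting a relation at a gap in the exponents\<close>

text \<open>Up to a constant this is \<open>(q - 1) *s geo_comb q I b e\<close>. Unlike geometric
  sums, pure powers are just multiplied by \<open>q ^ k\<close> when all exponents rise by
  \<open>k\<close>, and they admit divisibility arguments.\<close>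

definition pow_comb :: "int \<Rightarrow> nat set \<Rightarrow> (nat \<Rightarrow> int ^ 'm) \<Rightarrow> (nat \<Rightarrow> nat) \<Rightarrow> int ^ 'm" where
  "pow_comb q I b e = (\<Sum>i\<in>I. q ^ Suc (e i) *s b i)"

lemma geo_comb_closed_form: "(q - 1) *s geo_comb q I b e = pow_comb q I b e - sum b I"
proof -
  have "(q - 1) *s geo_comb q I b e = (\<Sum>i\<in>I. ((q - 1) * geo q (e i)) *s b i)"
    by (simp add: geo_comb_def ivec.scale_sum_right)
  also have "\<dots> = pow_comb q I b e - sum b I"
    unfolding geo_closed_form pow_comb_def by (simp add: ivec.scale_left_diff_distrib sum_subtractf)
  finally show ?thesis .
qed

lemma ivec_cancel:
  fixes x y :: "int ^ 'm"
  assumes "k \<noteq> 0" "k *s x = k *s y"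
  shows "x = y"
  using assms by (simp add: vec_eq_iff)

lemma geo_comb_eq_iff:
  assumes "q \<noteq> 1"
  shows "c + geo_comb q I b e = c' + geo_comb q J a f \<longleftrightarrow>
    (q - 1) *s c - sum b I + pow_comb q I b e = (q - 1) *s c' - sum a J + pow_comb q J a f"
proof -
  have "c + geo_comb q I b e = c' + geo_comb q J a f \<longleftrightarrow>
    (q - 1) *s (c + geo_comb q I b e) = (q - 1) *s (c' + geo_comb q J a f)"
    using ivec_cancel[of "q - 1"] assms by auto
  also have "\<dots> \<longleftrightarrow> (q - 1) *s c + (pow_comb q I b e - sum b I) =
      (q - 1) *s c' + (pow_comb q J a f - sum a J)"
    unfolding ivec.scale_right_distrib geo_comb_closed_form ..
  finally show ?thesis by (simp only: add_diff_eq diff_add_eq)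
qed

lemma small_multiple_is_zero:
  fixes x y :: int
  assumes "y dvd x" "\<bar>x\<bar> < y"
  shows "x = 0"
  using assms dvd_imp_le_int[of x y] by (cases "x = 0") auto

text \<open>The bound takes all coefficients in \<open>I\<close>, not only those in
  \<open>U\<close>, so the constant is the same wherever \<open>I\<close> is cut.\<close>

lemma abs_sum_pow_le:
  fixes q :: int
  assumes "q \<ge> 1" "finite I" "U \<subseteq> I" "\<And>i. i \<in> U \<Longrightarrow> e i < t"
  shows "\<bar>\<Sum>i\<in>U. q ^ Suc (e i) * b i\<bar> \<le> q ^ t * (\<Sum>i\<in>I. \<bar>b i\<bar>)"
proof -
  have "\<bar>\<Sum>i\<in>U. q ^ Suc (e i) * b i\<bar> \<le> (\<Sum>i\<in>U. q ^ t * \<bar>b i\<bar>)"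
  proof (rule order_trans[OF sum_abs sum_mono])
    fix i assume "i \<in> U"
    then have "q ^ Suc (e i) \<le> q ^ t"
      using assms by (intro power_increasing) (auto simp: Suc_le_eq)
    then show "\<bar>q ^ Suc (e i) * b i\<bar> \<le> q ^ t * \<bar>b i\<bar>"
      unfolding abs_mult using assms(1) by (intro mult_right_mono) auto
  qed
  also have "\<dots> = q ^ t * (\<Sum>i\<in>U. \<bar>b i\<bar>)" by (simp add: sum_distrib_left)
  also have "\<dots> \<le> q ^ t * (\<Sum>i\<in>I. \<bar>b i\<bar>)"
    using assms by (intro mult_left_mono sum_mono2) auto
  finally show ?thesis .
qed

text \<open>The difference of the upper parts equals the constant plus a difference of lower terms.
  The first form is divisible by \<open>q ^ (t + G + 1)\<close>, the second is smaller than this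
  power, so it vanishes.\<close>

lemma int_upper_parts_eq:
  fixes q C :: int and a b :: "nat \<Rightarrow> int"
  assumes q: "q \<ge> 2" and fin: "finite I" "finite J"
    and G: "\<bar>C\<bar> + (\<Sum>i\<in>I. \<bar>b i\<bar>) + (\<Sum>j\<in>J. \<bar>a j\<bar>) \<le> q ^ G"
    and eq: "C + (\<Sum>i\<in>I. q ^ Suc (e i) * b i) = (\<Sum>j\<in>J. q ^ Suc (f j) * a j)"
    and gap: "\<And>i. i \<in> I \<Longrightarrow> e i < t \<or> t + G \<le> e i" "\<And>j. j \<in> J \<Longrightarrow> f j < t \<or> t + G \<le> f j"
  shows "(\<Sum>i\<in>{i\<in>I. t \<le> e i}. q ^ Suc (e i) * b i) = (\<Sum>j\<in>{j\<in>J. t \<le> f j}. q ^ Suc (f j) * a j)"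
proof -
  define UI where "UI = {i\<in>I. t \<le> e i}"
  define UJ where "UJ = {j\<in>J. t \<le> f j}"
  define LI where "LI = {i\<in>I. \<not> t \<le> e i}"
  define LJ where "LJ = {j\<in>J. \<not> t \<le> f j}"
  define low where "low = C + (\<Sum>i\<in>LI. q ^ Suc (e i) * b i) - (\<Sum>j\<in>LJ. q ^ Suc (f j) * a j)"
  have split: "(\<Sum>i\<in>I. g i) = (\<Sum>i\<in>UI. g i) + (\<Sum>i\<in>LI. g i)"
    "(\<Sum>j\<in>J. g j) = (\<Sum>j\<in>UJ. g j) + (\<Sum>j\<in>LJ. g j)" for g :: "nat \<Rightarrow> int"
    using sum.Int_Diff[OF fin(1), of g "{i. t \<le> e i}"] sum.Int_Diff[OF fin(2), of g "{j. t \<le> f j}"]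
    by (simp_all add: UI_def UJ_def LI_def LJ_def Int_def set_diff_eq)
  have low_eq: "low = (\<Sum>j\<in>UJ. q ^ Suc (f j) * a j) - (\<Sum>i\<in>UI. q ^ Suc (e i) * b i)"
    using eq unfolding low_def split by simp
  have "q ^ (t + G + 1) dvd low"
    unfolding low_eq
    by (intro dvd_diff dvd_sum dvd_mult2 le_imp_power_dvd) (use gap in \<open>force simp: UI_def UJ_def\<close>)+
  moreover have "\<bar>low\<bar> < q ^ (t + G + 1)"
  proof -
    have "\<bar>low\<bar> \<le> \<bar>C\<bar> + \<bar>\<Sum>i\<in>LI. q ^ Suc (e i) * b i\<bar> + \<bar>\<Sum>j\<in>LJ. q ^ Suc (f j) * a j\<bar>"
      unfolding low_def by simp
    also have "\<dots> \<le> q ^ t * \<bar>C\<bar> + q ^ t * (\<Sum>i\<in>I. \<bar>b i\<bar>) + q ^ t * (\<Sum>j\<in>J. \<bar>a j\<bar>)"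
    proof (intro add_mono abs_sum_pow_le)
      show "\<bar>C\<bar> \<le> q ^ t * \<bar>C\<bar>"
        using q by (simp add: mult_le_cancel_right1)
    qed (use q fin in \<open>auto simp: LI_def LJ_def\<close>)
    also have "\<dots> = q ^ t * (\<bar>C\<bar> + (\<Sum>i\<in>I. \<bar>b i\<bar>) + (\<Sum>j\<in>J. \<bar>a j\<bar>))"
      by (simp add: algebra_simps)
    also have "\<dots> \<le> q ^ t * q ^ G" using G q by (intro mult_left_mono) auto
    \<comment> \<open>Each exponent enters as \<open>q ^ Suc (e i)\<close>; this extra factor
      \<open>q\<close> in the divisor makes the comparison strict.\<close>
    also have "\<dots> < q ^ (t + G + 1)" using q by (simp add: power_add)
    finally show ?thesis .
  qed
  ultimately have "low = 0" by (rule small_multiple_is_zero)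
  then show ?thesis using low_eq unfolding UI_def UJ_def by simp
qed

text \<open>The order of quantifiers matters: the gap length depends on coefficients and constants
  only and serves all exponents and thresholds. The integer case is applied in each
  coordinate.\<close>

lemma upper_parts_eq:
  fixes a b :: "nat \<Rightarrow> int ^ 'm"
  assumes q: "q \<ge> 2" and fin: "finite I" "finite J"
  shows "\<exists>G\<ge>1. \<forall>e f t. c + geo_comb q I b e = c' + geo_comb q J a f \<longrightarrow>
    (\<forall>i\<in>I. e i < t \<or> t + G \<le> e i) \<longrightarrow> (\<forall>j\<in>J. f j < t \<or> t + G \<le> f j) \<longrightarrow>
    pow_comb q {i\<in>I. t \<le> e i} b e = pow_comb q {j\<in>J. t \<le> f j} a f"
proof -
  define C where "C = (q - 1) *s (c - c') - sum b I + sum a J"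
  define K where "K l = \<bar>C $ l\<bar> + (\<Sum>i\<in>I. \<bar>b i $ l\<bar>) + (\<Sum>j\<in>J. \<bar>a j $ l\<bar>)" for l
  \<comment> \<open>The sum over the coordinates dominates every \<open>K l\<close>, and
    \<open>n < 2 ^ n\<close> turns it into a bound by \<open>q ^ G\<close>. \<open>Suc\<close>
    ensures \<open>G \<ge> 1\<close>.\<close>
  define G where "G = Suc (nat (\<Sum>l\<in>UNIV. K l))"
  have K0: "K l \<ge> 0" for l unfolding K_def by (intro add_nonneg_nonneg sum_nonneg) auto
  have KG: "K l \<le> q ^ G" for l
  proof -
    have "K l \<le> (\<Sum>l\<in>UNIV. K l)" using K0 by (intro member_le_sum) auto
    also have "\<dots> \<le> int G" unfolding G_def by simp
    also have "\<dots> \<le> int (2 ^ G)" by (meson less_exp less_imp_le of_nat_mono)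
    also have "\<dots> \<le> q ^ G" using q by (simp add: power_mono)
    finally show ?thesis .
  qed
  show ?thesis
  proof (intro exI[of _ G] conjI allI impI)
    show "G \<ge> 1" by (simp add: G_def)
    fix e f t
    assume eq: "c + geo_comb q I b e = c' + geo_comb q J a f"
      and gap: "\<forall>i\<in>I. e i < t \<or> t + G \<le> e i" "\<forall>j\<in>J. f j < t \<or> t + G \<le> f j"
    have eq': "C + pow_comb q I b e = pow_comb q J a f"
      using eq q by (simp add: geo_comb_eq_iff C_def ivec.scale_right_diff_distrib algebra_simps)
    show "pow_comb q {i\<in>I. t \<le> e i} b e = pow_comb q {j\<in>J. t \<le> f j} a f"
    proof (subst vec_eq_iff, rule allI)
      fix l
      have "C $ l + (\<Sum>i\<in>I. q ^ Suc (e i) * b i $ l) = (\<Sum>j\<in>J. q ^ Suc (f j) * a j $ l)"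
        using arg_cong[OF eq', of "\<lambda>v. v $ l"] by (simp add: pow_comb_def)
      from int_upper_parts_eq[OF q fin KG[of l, unfolded K_def] this gap[rule_format]]
      show "pow_comb q {i\<in>I. t \<le> e i} b e $ l = pow_comb q {j\<in>J. t \<le> f j} a f $ l"
        by (simp add: pow_comb_def)
    qed
  qed
qed

text \<open>Pigeonhole: of \<open>card J + 1\<close> consecutive windows of length \<open>G\<close>
  starting at \<open>s\<close>, one contains no value \<open>f j\<close>.\<close>

lemma free_window:
  fixes f :: "nat \<Rightarrow> nat"
  assumes "finite J"
  shows "\<exists>t\<ge>s. t + G \<le> s + Suc (card J) * G \<and> (\<forall>j\<in>J. f j < t \<or> t + G \<le> f j)"
proof -
  have "\<exists>k\<le>card J. \<forall>j\<in>J. f j < s + k * G \<or> s + k * G + G \<le> f j"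
  proof (rule ccontr)
    assume "\<not> ?thesis"
    then have "\<forall>k\<in>{..card J}. \<exists>j\<in>J. s + k * G \<le> f j \<and> f j < s + k * G + G"
      by (meson atMost_iff not_le)
    then have "\<forall>k. \<exists>j. k \<le> card J \<longrightarrow> j \<in> J \<and> s + k * G \<le> f j \<and> f j < s + k * G + G"
      by auto
    from choice[OF this] obtain h where
      h: "\<And>k. k \<le> card J \<Longrightarrow> h k \<in> J \<and> s + k * G \<le> f (h k) \<and> f (h k) < s + k * G + G"
      by auto
    have less: "f (h k) < f (h k')" if "k < k'" "k' \<le> card J" for k k'
    proof -
      have "f (h k) < s + Suc k * G" using h[of k] that by simp
      also have "\<dots> \<le> s + k' * G" using that by (intro add_left_mono mult_right_mono) auto
      also have "\<dots> \<le> f (h k')" using h[of k'] that by simp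
      finally show ?thesis .
    qed
    have "inj_on h {..card J}"
    proof (rule linorder_inj_onI)
      fix k k' assume "k < k'" "k \<in> {..card J}" "k' \<in> {..card J}"
      then show "h k \<noteq> h k'" using less[of k k'] by auto
    qed auto
    moreover have "h ` {..card J} \<subseteq> J" using h by auto
    ultimately have "card {..card J} \<le> card J" using assms by (metis card_inj_on_le)
    then show False by simp
  qed
  then obtain k where k: "k \<le> card J" "\<forall>j\<in>J. f j < s + k * G \<or> s + k * G + G \<le> f j" by blast
  show ?thesis
  proof (intro exI[of _ "s + k * G"] conjI)
    show "s + k * G + G \<le> s + Suc (card J) * G"
      using mult_le_mono1[OF k(1), of G] by simp
  qed (use k in auto)
qed

text \<open>The blocks move by \<open>p' - p\<close>, which may be negative.\<close>

lemma geo_comb_shift_blocks: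
  fixes a b :: "nat \<Rightarrow> int ^ 'm"
  assumes q: "q \<ge> 2" and fin: "finite I" "finite J" and sub: "UI \<subseteq> I" "UJ \<subseteq> J"
    and eq: "c + geo_comb q I b e = c' + geo_comb q J a f"
    and block: "pow_comb q UI b e = pow_comb q UJ a f"
    and shift: "\<And>i. i \<in> UI \<Longrightarrow> e' i + p = e i + p'" "\<And>j. j \<in> UJ \<Longrightarrow> f' j + p = f j + p'"
    and fixed: "\<And>i. i \<in> I - UI \<Longrightarrow> e' i = e i" "\<And>j. j \<in> J - UJ \<Longrightarrow> f' j = f j"
  shows "c + geo_comb q I b e' = c' + geo_comb q J a f'"
proof -
  have scale: "q ^ p *s pow_comb q U w h' = q ^ p' *s pow_comb q U w h"
    if "\<And>i. i \<in> U \<Longrightarrow> h' i + p = h i + p'" for U h h' and w :: "nat \<Rightarrow> int ^ 'm"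
  proof -
    have "q ^ p * q ^ Suc (h' i) = q ^ p' * q ^ Suc (h i)" if "i \<in> U" for i
    proof -
      have "p + Suc (h' i) = p' + Suc (h i)" using \<open>\<And>i. i \<in> U \<Longrightarrow> h' i + p = h i + p'\<close>[OF that] by simp
      then show ?thesis by (metis power_add)
    qed
    then show ?thesis unfolding pow_comb_def ivec.scale_sum_right ivec.scale_scale
      by (intro sum.cong arg_cong2[of _ _ _ _ "(*s)"] refl)
  qed
  have "q ^ p *s pow_comb q UI b e' = q ^ p' *s pow_comb q UJ a f"
    unfolding block[symmetric] using shift(1) by (rule scale)
  also have "\<dots> = q ^ p *s pow_comb q UJ a f'"
    by (rule scale[symmetric]) (rule shift(2))
  finally have block': "pow_comb q UI b e' = pow_comb q UJ a f'"
    by (rule ivec_cancel[rotated]) (use q in simp)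
  have split: "pow_comb q K w h = pow_comb q (K - U) w h + pow_comb q U w h"
    if "finite K" "U \<subseteq> K" for K U h and w :: "nat \<Rightarrow> int ^ 'm"
    unfolding pow_comb_def using that by (intro sum.subset_diff)
  have same: "pow_comb q (I - UI) b e' = pow_comb q (I - UI) b e"
    "pow_comb q (J - UJ) a f' = pow_comb q (J - UJ) a f"
    using fixed by (auto simp: pow_comb_def)
  have "q \<noteq> 1" using q by simp
  then show ?thesis
    using eq block block' same
    unfolding geo_comb_eq_iff[OF \<open>q \<noteq> 1\<close>] split[OF fin(1) sub(1)] split[OF fin(2) sub(2)]
    by (simp add: add.assoc[symmetric])
qed

lemma geo_comb_remove:
  "\<lbrakk>finite I; i \<in> I\<rbrakk> \<Longrightarrow> geo_comb q I b e = geo q (e i) *s b i + geo_comb q (I - {i}) b e"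
  unfolding geo_comb_def by (rule sum.remove)

subsection \<open>Invariance of membership under changes of the exponents\<close>

text \<open>A large gap in \<open>e\<close> contains a window of length \<open>G\<close> that the
  exponents \<open>f\<close> of a representation in the other set avoid as well. By
  \<open>upper_parts_eq\<close> the parts above the window agree, so they can be raised or lowered
  together.\<close>

lemma geo_set_stretch_Suc:
  fixes a b :: "nat \<Rightarrow> int ^ 'm"
  assumes q: "q \<ge> 2" and fin: "finite I" "finite J"
  shows "\<exists>M. \<forall>e t. (\<forall>i\<in>I. e i < t \<or> t + M \<le> e i) \<longrightarrow>
    (c + geo_comb q I b (\<lambda>i. if t \<le> e i then Suc (e i) else e i) \<in> geo_set q R J c' a \<longleftrightarrow>
     c + geo_comb q I b e \<in> geo_set q R J c' a)"
proof -
  obtain G where G: "G \<ge> 1" and "\<forall>e f t. c + geo_comb q I b e = c' + geo_comb q J a f \<longrightarrow>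
      (\<forall>i\<in>I. e i < t \<or> t + G \<le> e i) \<longrightarrow> (\<forall>j\<in>J. f j < t \<or> t + G \<le> f j) \<longrightarrow>
      pow_comb q {i\<in>I. t \<le> e i} b e = pow_comb q {j\<in>J. t \<le> f j} a f"
    using upper_parts_eq[OF q fin, of c b c' a] by (elim exE conjE)
  note upper = this(2)[rule_format]
  define M where "M = Suc (card J) * G"
  show ?thesis
  proof (intro exI[of _ M] allI impI)
    fix e t assume "\<forall>i\<in>I. e i < t \<or> t + M \<le> e i"
    note gap = this[rule_format]
    define e1 where "e1 = (\<lambda>i. if t \<le> e i then Suc (e i) else e i)"
    have gap1: "e1 i < t \<or> t + M \<le> e1 i" if "i \<in> I" for i
      using gap[OF that] by (auto simp: e1_def)
    have *: "c + geo_comb q I b e1 \<in> geo_set q R J c' a"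
      if mem: "c + geo_comb q I b e \<in> geo_set q R J c' a"
    proof -
      from mem obtain f where eq: "c + geo_comb q I b e = c' + geo_comb q J a f"
        and ord: "\<And>i j. i \<in> J \<Longrightarrow> j \<in> J \<Longrightarrow> R i j \<Longrightarrow> f j < f i"
        unfolding geo_set_def by blast
      obtain s where s: "t \<le> s" "s + G \<le> t + M" and fgap: "\<forall>j\<in>J. f j < s \<or> s + G \<le> f j"
        using free_window[OF fin(2), of t G f] unfolding M_def by (elim exE conjE)
      note fgap = fgap[rule_format]
      have egap: "e i < s \<or> s + G \<le> e i" if "i \<in> I" for i using gap[OF that] s by auto
      define f1 where "f1 = (\<lambda>j. if s \<le> f j then Suc (f j) else f j)"
      have "c + geo_comb q I b e1 = c' + geo_comb q J a f1"
      proof (rule geo_comb_shift_blocks[OF q fin _ _ eq upper[OF eq egap fgap], where p = 0 and p' = 1])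
        show "e1 i + 0 = e i + 1" if "i \<in> {i \<in> I. s \<le> e i}" for i
          using that s by (auto simp: e1_def)
        show "e1 i = e i" if "i \<in> I - {i \<in> I. s \<le> e i}" for i
          using that s G gap[of i] by (auto simp: e1_def)
      qed (auto simp: f1_def)
      moreover have "\<forall>i\<in>J. \<forall>j\<in>J. R i j \<longrightarrow> f1 j < f1 i"
        using ord by (fastforce simp: f1_def)
      ultimately show ?thesis unfolding geo_set_def by blast
    qed
    have "c + geo_comb q I b e \<in> geo_set q R J c' a"
      if mem: "c + geo_comb q I b e1 \<in> geo_set q R J c' a"
    proof -
      from mem obtain f where eq: "c + geo_comb q I b e1 = c' + geo_comb q J a f"
        and ord: "\<And>i j. i \<in> J \<Longrightarrow> j \<in> J \<Longrightarrow> R i j \<Longrightarrow> f j < f i"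
        unfolding geo_set_def by blast
      obtain s where s: "t \<le> s" "s + G \<le> t + M" and fgap: "\<forall>j\<in>J. f j < s \<or> s + G \<le> f j"
        using free_window[OF fin(2), of t G f] unfolding M_def by (elim exE conjE)
      note fgap = fgap[rule_format]
      have egap: "e1 i < s \<or> s + G \<le> e1 i" if "i \<in> I" for i using gap1[OF that] s by auto
      \<comment> \<open>Since \<open>G \<ge> 1\<close>, exponents at or above \<open>s\<close> are
        even above \<open>s\<close>. After the decrement they still exceed those below
        \<open>s\<close>, so the order is kept.\<close>
      define f1 where "f1 = (\<lambda>j. if s \<le> f j then f j - 1 else f j)"
      have "c + geo_comb q I b e = c' + geo_comb q J a f1"
      proof (rule geo_comb_shift_blocks[OF q fin _ _ eq upper[OF eq egap fgap], where p = 1 and p' = 0])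
        show "e i + 1 = e1 i + 0" if "i \<in> {i \<in> I. s \<le> e1 i}" for i
          using that s by (auto simp: e1_def split: if_splits)
        show "e i = e1 i" if "i \<in> I - {i \<in> I. s \<le> e1 i}" for i
          using that s G gap[of i] by (auto simp: e1_def split: if_splits)
        show "f1 j + 1 = f j + 0" if "j \<in> {j \<in> J. s \<le> f j}" for j
          using that fgap[of j] G by (auto simp: f1_def)
      qed (auto simp: f1_def)
      moreover have "\<forall>i\<in>J. \<forall>j\<in>J. R i j \<longrightarrow> f1 j < f1 i"
      proof (intro ballI impI)
        fix i j assume "i \<in> J" "j \<in> J" "R i j"
        then show "f1 j < f1 i" using ord[of i j] fgap[of i] fgap[of j] G by (auto simp: f1_def)
      qed
      ultimately show ?thesis unfolding geo_set_def by blast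
    qed
    with * show "c + geo_comb q I b (\<lambda>i. if t \<le> e i then Suc (e i) else e i) \<in> geo_set q R J c' a \<longleftrightarrow>
      c + geo_comb q I b e \<in> geo_set q R J c' a" unfolding e1_def by blast
  qed
qed

text \<open>\<open>M\<close> depends on \<open>c\<close>, \<open>b\<close> and \<open>I\<close>
  only. The gap may also lie below all exponents, in which case every exponent is raised.\<close>

definition stretchable :: "int \<Rightarrow> (int ^ 'm) set \<Rightarrow> bool" where
  "stretchable q A \<longleftrightarrow> (\<forall>c b I. finite I \<longrightarrow> (\<exists>M. \<forall>e t \<Delta>. (\<forall>i\<in>I. e i < t \<or> t + M \<le> e i) \<longrightarrow>
     (c + geo_comb q I b (\<lambda>i. if t \<le> e i then e i + \<Delta> else e i) \<in> A \<longleftrightarrow> c + geo_comb q I b e \<in> A)))"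

lemma stretchable_geo_set:
  fixes a :: "nat \<Rightarrow> int ^ 'm"
  assumes q: "q \<ge> 2" and "finite J"
  shows "stretchable q (geo_set q R J c' a)"
  unfolding stretchable_def
proof (intro allI impI)
  fix c and b :: "nat \<Rightarrow> int ^ 'm" and I :: "nat set" assume "finite I"
  obtain M where "\<forall>e t. (\<forall>i\<in>I. e i < t \<or> t + M \<le> e i) \<longrightarrow>
      (c + geo_comb q I b (\<lambda>i. if t \<le> e i then Suc (e i) else e i) \<in> geo_set q R J c' a \<longleftrightarrow>
       c + geo_comb q I b e \<in> geo_set q R J c' a)"
    using geo_set_stretch_Suc[OF q \<open>finite I\<close> assms(2), of c b R c' a] ..
  note M = this[rule_format]
  have "c + geo_comb q I b (\<lambda>i. if t \<le> e i then e i + \<Delta> else e i) \<in> geo_set q R J c' a \<longleftrightarrow>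
      c + geo_comb q I b e \<in> geo_set q R J c' a"
    if gap: "\<forall>i\<in>I. e i < t \<or> t + M \<le> e i" for e t \<Delta>
  proof (induction \<Delta>)
    case 0
    have "(\<lambda>i. if t \<le> e i then e i + 0 else e i) = e" by auto
    then show ?case by (simp only:)
  next
    case (Suc \<Delta>)
    let ?e = "\<lambda>i. if t \<le> e i then e i + \<Delta> else e i"
    have "(\<lambda>i. if t \<le> e i then e i + Suc \<Delta> else e i) = (\<lambda>i. if t \<le> ?e i then Suc (?e i) else ?e i)"
      by auto
    moreover have "?e i < t \<or> t + M \<le> ?e i" if "i \<in> I" for i
      using gap that by (auto simp: trans_le_add1)
    ultimately show ?case using M[of ?e t] Suc by simp
  qed
  then show "\<exists>M. \<forall>e t \<Delta>. (\<forall>i\<in>I. e i < t \<or> t + M \<le> e i) \<longrightarrow>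
     (c + geo_comb q I b (\<lambda>i. if t \<le> e i then e i + \<Delta> else e i) \<in> geo_set q R J c' a \<longleftrightarrow>
      c + geo_comb q I b e \<in> geo_set q R J c' a)" by blast
qed

lemma stretchable_Un:
  fixes A B :: "(int ^ 'm) set"
  assumes "stretchable q A" "stretchable q B"
  shows "stretchable q (A \<union> B)"
  unfolding stretchable_def
proof (intro allI impI)
  fix c and b :: "nat \<Rightarrow> int ^ 'm" and I :: "nat set" assume I: "finite I"
  obtain M where M: "\<forall>e t \<Delta>. (\<forall>i\<in>I. e i < t \<or> t + M \<le> e i) \<longrightarrow>
     (c + geo_comb q I b (\<lambda>i. if t \<le> e i then e i + \<Delta> else e i) \<in> A \<longleftrightarrow> c + geo_comb q I b e \<in> A)"
    using assms(1)[unfolded stretchable_def, rule_format, OF I, of c b] ..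
  obtain N where N: "\<forall>e t \<Delta>. (\<forall>i\<in>I. e i < t \<or> t + N \<le> e i) \<longrightarrow>
     (c + geo_comb q I b (\<lambda>i. if t \<le> e i then e i + \<Delta> else e i) \<in> B \<longleftrightarrow> c + geo_comb q I b e \<in> B)"
    using assms(2)[unfolded stretchable_def, rule_format, OF I, of c b] ..
  show "\<exists>M. \<forall>e t \<Delta>. (\<forall>i\<in>I. e i < t \<or> t + M \<le> e i) \<longrightarrow>
     (c + geo_comb q I b (\<lambda>i. if t \<le> e i then e i + \<Delta> else e i) \<in> A \<union> B \<longleftrightarrow>
      c + geo_comb q I b e \<in> A \<union> B)"
  proof (intro exI[of _ "M + N"] allI impI)
    fix e t \<Delta> assume "\<forall>i\<in>I. e i < t \<or> t + (M + N) \<le> e i"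
    then have "\<forall>i\<in>I. e i < t \<or> t + M \<le> e i" "\<forall>i\<in>I. e i < t \<or> t + N \<le> e i" by force+
    then show "c + geo_comb q I b (\<lambda>i. if t \<le> e i then e i + \<Delta> else e i) \<in> A \<union> B \<longleftrightarrow>
      c + geo_comb q I b e \<in> A \<union> B" using M N by blast
  qed
qed

lemma stretchable_Union:
  "\<lbrakk>finite \<V>; \<And>V. V \<in> \<V> \<Longrightarrow> stretchable q V\<rbrakk> \<Longrightarrow> stretchable q (\<Union>\<V>)"
proof (induction rule: finite_induct)
  case empty
  show ?case by (simp add: stretchable_def)
qed (simp add: stretchable_Un)

text \<open>The lower bound on single exponents separates them from the constant \<open>c\<close>,
  just as they are separated from each other.\<close>

definition generic :: "nat \<Rightarrow> nat set \<Rightarrow> (nat \<Rightarrow> nat) \<Rightarrow> bool" where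
  "generic M I e \<longleftrightarrow> (\<forall>i\<in>I. M \<le> e i) \<and> (\<forall>i\<in>I. \<forall>j\<in>I. i \<noteq> j \<longrightarrow> e i + M \<le> e j \<or> e j + M \<le> e i)"

lemma generic_mono: "\<lbrakk>generic M I e; N \<le> M\<rbrakk> \<Longrightarrow> generic N I e"
  unfolding generic_def by (meson add_left_mono order_trans)

text \<open>In contrast to \<open>stretchable\<close>, the order of the exponents must not influence
  membership either.\<close>

definition tame :: "int \<Rightarrow> (int ^ 'm) set \<Rightarrow> bool" where
  "tame q A \<longleftrightarrow> (\<forall>c b I. finite I \<longrightarrow> (\<exists>M. \<forall>e e'. generic M I e \<longrightarrow> generic M I e' \<longrightarrow>
     (c + geo_comb q I b e \<in> A \<longleftrightarrow> c + geo_comb q I b e' \<in> A)))"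

lemma tame_Compl: "tame q A \<Longrightarrow> tame q (- A)"
  unfolding tame_def by simp

lemma tame_Int:
  fixes A B :: "(int ^ 'm) set"
  assumes "tame q A" "tame q B"
  shows "tame q (A \<inter> B)"
  unfolding tame_def
proof (intro allI impI)
  fix c and b :: "nat \<Rightarrow> int ^ 'm" and I :: "nat set" assume I: "finite I"
  obtain M where M: "\<forall>e e'. generic M I e \<longrightarrow> generic M I e' \<longrightarrow>
      (c + geo_comb q I b e \<in> A \<longleftrightarrow> c + geo_comb q I b e' \<in> A)"
    using assms(1)[unfolded tame_def, rule_format, OF I, of c b] ..
  obtain N where N: "\<forall>e e'. generic N I e \<longrightarrow> generic N I e' \<longrightarrow>
      (c + geo_comb q I b e \<in> B \<longleftrightarrow> c + geo_comb q I b e' \<in> B)"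
    using assms(2)[unfolded tame_def, rule_format, OF I, of c b] ..
  show "\<exists>M. \<forall>e e'. generic M I e \<longrightarrow> generic M I e' \<longrightarrow>
     (c + geo_comb q I b e \<in> A \<inter> B \<longleftrightarrow> c + geo_comb q I b e' \<in> A \<inter> B)"
  proof (intro exI[of _ "M + N"] allI impI)
    fix e e' assume "generic (M + N) I e" "generic (M + N) I e'"
    then have "generic M I e" "generic M I e'" "generic N I e" "generic N I e'"
      by (auto intro: generic_mono)
    then show "c + geo_comb q I b e \<in> A \<inter> B \<longleftrightarrow> c + geo_comb q I b e' \<in> A \<inter> B"
      using M N by blast
  qed
qed

text \<open>Windows just below and just above \<open>e i\<close> isolate the term of
  \<open>i\<close>. Subtracting the two equations between upper parts shows that it equals a block
  of terms of the other sum; as no order is imposed on \<open>J\<close>, this block can move along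
  with it.\<close>

lemma free_geo_set_move:
  fixes a b :: "nat \<Rightarrow> int ^ 'm"
  assumes q: "q \<ge> 2" and fin: "finite I" "finite J"
  shows "\<exists>M. \<forall>e i t. generic M I e \<longrightarrow> i \<in> I \<longrightarrow> M \<le> t \<longrightarrow>
    c + geo_comb q I b e \<in> free_geo_set q J c' a \<longrightarrow> c + geo_comb q I b (e(i := t)) \<in> free_geo_set q J c' a"
proof -
  obtain G where G: "G \<ge> 1" and "\<forall>e f t. c + geo_comb q I b e = c' + geo_comb q J a f \<longrightarrow>
      (\<forall>i\<in>I. e i < t \<or> t + G \<le> e i) \<longrightarrow> (\<forall>j\<in>J. f j < t \<or> t + G \<le> f j) \<longrightarrow>
      pow_comb q {i\<in>I. t \<le> e i} b e = pow_comb q {j\<in>J. t \<le> f j} a f"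
    using upper_parts_eq[OF q fin, of c b c' a] by (elim exE conjE)
  note upper = this(2)[rule_format]
  define L where "L = Suc (card J) * G"
  show ?thesis
  proof (intro exI[of _ "Suc L"] allI impI)
    fix e i t
    assume gen: "generic (Suc L) I e" and i: "i \<in> I" and t: "Suc L \<le> t"
      and "c + geo_comb q I b e \<in> free_geo_set q J c' a"
    then obtain f where eq: "c + geo_comb q I b e = c' + geo_comb q J a f"
      unfolding geo_set_def by blast
    have ei: "Suc L \<le> e i" and far: "\<And>j. j \<in> I \<Longrightarrow> j \<noteq> i \<Longrightarrow> e j + Suc L \<le> e i \<or> e i + Suc L \<le> e j"
      using gen i unfolding generic_def by blast+
    \<comment> \<open>The margin \<open>Suc L\<close> leaves room for \<open>card J + 1\<close>
      windows on either side of \<open>e i\<close> before another exponent of \<open>e\<close> is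
      reached.\<close>
    obtain s1 where s1: "e i - L \<le> s1" "s1 + G \<le> e i - L + L"
      and fgap1: "\<forall>j\<in>J. f j < s1 \<or> s1 + G \<le> f j"
      using free_window[OF fin(2), of "e i - L" G f] unfolding L_def[symmetric] by (elim exE conjE)
    note fgap1 = fgap1[rule_format]
    obtain s2 where s2: "Suc (e i) \<le> s2" "s2 + G \<le> Suc (e i) + L"
      and fgap2: "\<forall>j\<in>J. f j < s2 \<or> s2 + G \<le> f j"
      using free_window[OF fin(2), of "Suc (e i)" G f] unfolding L_def[symmetric] by (elim exE conjE)
    note fgap2 = fgap2[rule_format]
    have egap1: "e j < s1 \<or> s1 + G \<le> e j" if "j \<in> I" for j
      using far[OF that] s1 ei by (cases "j = i") auto
    have egap2: "e j < s2 \<or> s2 + G \<le> e j" if "j \<in> I" for j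
      using far[OF that] s2 by (cases "j = i") auto
    define U where "U = {j\<in>J. s1 \<le> f j \<and> f j < s2}"
    have I1: "{j\<in>I. s1 \<le> e j} = insert i {j\<in>I. s2 \<le> e j}"
    proof -
      have "s1 \<le> e j \<longleftrightarrow> j = i \<or> s2 \<le> e j" if "j \<in> I" for j
        using far[OF that] s1 s2 ei by (cases "j = i") auto
      then show ?thesis using i by blast
    qed
    have J1: "{j\<in>J. s1 \<le> f j} = U \<union> {j\<in>J. s2 \<le> f j}"
      using s1 s2 ei by (auto simp: U_def)
    have "pow_comb q {i} b e + pow_comb q {j\<in>I. s2 \<le> e j} b e = pow_comb q {j\<in>I. s1 \<le> e j} b e"
      unfolding I1 pow_comb_def using fin(1) s2 by simp
    also have "\<dots> = pow_comb q {j\<in>J. s1 \<le> f j} a f"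
      by (rule upper[OF eq egap1 fgap1])
    also have "\<dots> = pow_comb q U a f + pow_comb q {j\<in>J. s2 \<le> f j} a f"
      unfolding J1 pow_comb_def using fin(2) by (intro sum.union_disjoint) (auto simp: U_def)
    finally have block: "pow_comb q {i} b e = pow_comb q U a f"
      using upper[OF eq egap2 fgap2] by simp
    \<comment> \<open>The subtraction is exact: \<open>f j \<ge> s1 \<ge> e i - L\<close> for
      \<open>j \<in> U\<close>, and \<open>t > L\<close>.\<close>
    define f1 where "f1 = (\<lambda>j. if j \<in> U then f j + t - e i else f j)"
    have "c + geo_comb q I b (e(i := t)) = c' + geo_comb q J a f1"
    proof (rule geo_comb_shift_blocks[OF q fin _ _ eq block, where p = "e i" and p' = t])
      show "f1 j + e i = f j + t" if "j \<in> U" for j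
        using that s1 t ei by (auto simp: f1_def U_def)
    qed (use i in \<open>auto simp: U_def f1_def\<close>)
    then show "c + geo_comb q I b (e(i := t)) \<in> free_geo_set q J c' a"
      unfolding geo_set_def by blast
  qed
qed

text \<open>Two generic exponent vectors are joined by changing one exponent at a time with
  \<open>free_geo_set_move\<close>, for which the vector before each change has to be
  generic.\<close>

lemma tame_free_geo_set:
  fixes a :: "nat \<Rightarrow> int ^ 'm"
  assumes q: "q \<ge> 2" and "finite J"
  shows "tame q (free_geo_set q J c' a)"
  unfolding tame_def
proof (intro allI impI)
  fix c and b :: "nat \<Rightarrow> int ^ 'm" and I :: "nat set" assume I: "finite I"
  let ?V = "free_geo_set q J c' a"
  obtain M where "\<forall>e i t. generic M I e \<longrightarrow> i \<in> I \<longrightarrow> M \<le> t \<longrightarrow>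
      c + geo_comb q I b e \<in> ?V \<longrightarrow> c + geo_comb q I b (e(i := t)) \<in> ?V"
    using free_geo_set_move[OF q I assms(2), of c b c' a] ..
  note move = this[rule_format]
  have path: "c + geo_comb q I b (override_on e e' I) \<in> ?V"
    if e: "c + geo_comb q I b e \<in> ?V"
      and gen: "\<And>S. S \<subseteq> I \<Longrightarrow> generic M I (override_on e e' S)" for e e'
  proof -
    have "S \<subseteq> I \<Longrightarrow> c + geo_comb q I b (override_on e e' S) \<in> ?V" if "finite S" for S
      using that
    proof (induction rule: finite_induct)
      case (insert i S)
      then have "generic M I (override_on e e' S)" "i \<in> I" "M \<le> e' i"
        using gen[of S] gen[of I] by (auto simp: generic_def)
      then show ?case
        unfolding override_on_insert using move[of "override_on e e' S" i "e' i"] insert by blast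
    qed (use e in simp)
    then show ?thesis using I by blast
  qed
  have "c + geo_comb q I b e' \<in> ?V"
    if gen: "generic M I e" "generic M I e'" and e: "c + geo_comb q I b e \<in> ?V" for e e'
  proof -
    \<comment> \<open>a detour through exponents far beyond both \<open>e\<close> and \<open>e'\<close> keeps all intermediate
      exponents generic\<close>
    define T where "T = (\<Sum>i\<in>I. e i + e' i) + M"
    define h where "h = (\<lambda>i. T + M * i)"
    have T: "e i + M \<le> T" "e' i + M \<le> T" if "i \<in> I" for i
    proof -
      have "e i + e' i \<le> (\<Sum>i\<in>I. e i + e' i)" using that I by (intro member_le_sum) auto
      then show "e i + M \<le> T" "e' i + M \<le> T" unfolding T_def by auto
    qed
    have h: "T \<le> h i" "M \<le> h i" "i < j \<Longrightarrow> h i + M \<le> h j" for i j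
    proof -
      show "h i + M \<le> h j" if "i < j"
      proof -
        have "M * Suc i \<le> M * j" using that by (intro mult_le_mono2) auto
        then show ?thesis unfolding h_def by simp
      qed
    qed (auto simp: h_def T_def)
    have mix: "generic M I (override_on g h S)"
      if "generic M I g" "\<And>i. i \<in> I \<Longrightarrow> g i + M \<le> T" for S g
      unfolding generic_def
    proof (intro conjI ballI impI)
      fix i assume "i \<in> I"
      then show "M \<le> override_on g h S i"
        using that(1) h(2)[of i] by (auto simp: generic_def override_on_def)
      fix j assume "j \<in> I" "i \<noteq> j"
      then show "override_on g h S i + M \<le> override_on g h S j \<or>
          override_on g h S j + M \<le> override_on g h S i"
        using \<open>i \<in> I\<close> that(1) that(2)[of i] that(2)[of j] h(1)[of i] h(1)[of j] h(3)[of i j] h(3)[of j i]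
        unfolding generic_def override_on_def by (cases "i < j") auto
    qed
    have gcong: "generic M I g \<Longrightarrow> (\<And>i. i \<in> I \<Longrightarrow> g i = g' i) \<Longrightarrow> generic M I g'" for g g'
      unfolding generic_def by simp
    have "c + geo_comb q I b (override_on e h I) \<in> ?V"
      using e mix[OF gen(1) T(1)] by (rule path)
    \<comment> \<open>Returning from \<open>h\<close> to \<open>e'\<close> on \<open>S\<close>
      amounts to overriding \<open>e'\<close> by \<open>h\<close> on \<open>I - S\<close>, so
      \<open>mix\<close> applies again.\<close>
    moreover have "generic M I (override_on (override_on e h I) e' S)" if "S \<subseteq> I" for S
      by (rule gcong[OF mix[OF gen(2) T(2), of "I - S"]]) (auto simp: override_on_def)
    ultimately have "c + geo_comb q I b (override_on (override_on e h I) e' I) \<in> ?V"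
      by (rule path)
    moreover have "geo_comb q I b (override_on (override_on e h I) e' I) = geo_comb q I b e'"
      by (intro geo_comb_cong) auto
    ultimately show ?thesis by simp
  qed
  then show "\<exists>M. \<forall>e e'. generic M I e \<longrightarrow> generic M I e' \<longrightarrow>
     (c + geo_comb q I b e \<in> ?V \<longleftrightarrow> c + geo_comb q I b e' \<in> ?V)" by blast
qed

subsection \<open>Tame subsets of unordered sets are Boolean combinations\<close>

text \<open>The bracket \<open>geo q t - q ^ t\<close> is the sum of the powers below
  \<open>q ^ t\<close>; it is 0 for \<open>t = 0\<close>.\<close>

lemma geo_add: "q \<noteq> 1 \<Longrightarrow> geo q (e + t) = (geo q t - q ^ t) + q ^ t * geo q e"
  by (cases t) (simp_all add: geo_Suc_add del: add_Suc_right, simp add: geo_def)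

text \<open>Two exponents at a fixed distance \<open>t\<close> are governed by one parameter:
  \<open>j\<close> contributes a constant and a change of the coefficient of \<open>i\<close>, so
  the rank drops by one.\<close>

lemma geo_comb_merge:
  assumes "q \<noteq> 1" "finite I" "i \<in> I" "j \<in> I" "i \<noteq> j" "e j = e i + t"
  shows "c + geo_comb q I b e = (c + (geo q t - q ^ t) *s b j) +
    geo_comb q (I - {j}) (b(i := b i + q ^ t *s b j)) e"
proof -
  have *: "geo_comb q (I - {j} - {i}) b e = geo_comb q (I - {j} - {i}) (b(i := b i + q ^ t *s b j)) e"
    by (intro geo_comb_cong) auto
  have "geo_comb q I b e = geo q (e j) *s b j + (geo q (e i) *s b i + geo_comb q (I - {j} - {i}) b e)"
    using assms by (subst geo_comb_remove[of _ j], simp, simp, subst geo_comb_remove[of _ i]) auto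
  also have "geo q (e j) *s b j = (geo q t - q ^ t) *s b j + geo q (e i) *s (q ^ t *s b j)"
    unfolding assms(6) geo_add[OF assms(1)] by (simp only: ivec.scale_left_distrib ivec.scale_scale mult.commute)
  finally have "geo_comb q I b e = (geo q t - q ^ t) *s b j +
      (geo q (e i) *s (b i + q ^ t *s b j) + geo_comb q (I - {j} - {i}) (b(i := b i + q ^ t *s b j)) e)"
    unfolding * by (simp only: ivec.scale_right_distrib ac_simps)
  also have "geo q (e i) *s (b i + q ^ t *s b j) + geo_comb q (I - {j} - {i}) (b(i := b i + q ^ t *s b j)) e =
      geo_comb q (I - {j}) (b(i := b i + q ^ t *s b j)) e"
    using assms by (subst geo_comb_remove[of "I - {j}" i]) auto
  finally show ?thesis by (simp add: add.assoc)
qed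

lemma C_set_eq: "C_set d a \<delta> = {geo (int d ^ \<delta>) n *s a | n. True}"
proof -
  have "(\<Sum>i\<le>n. int d ^ (i * \<delta>) *s a) = geo (int d ^ \<delta>) n *s a" for n
    unfolding geo_def ivec.scale_sum_left power_mult[symmetric] by (simp add: mult.commute)
  then show ?thesis unfolding C_set_def by simp
qed

lemma free_geo_set_in_translated_C_sums:
  assumes "finite I" "\<delta> > 0"
  shows "free_geo_set (int d ^ \<delta>) I c b \<in> translated_C_sums d"
proof -
  obtain h where h: "bij_betw h {..<card I} I"
    using ex_bij_betw_nat_finite[OF assms(1)] by (auto simp: atLeast0LessThan)
  have "(\<Sum>i<card I. C_set d ((b \<circ> h) i) \<delta>) = (\<Sum>i\<in>I. C_set d (b i) \<delta>)"
    using sum.reindex_bij_betw[OF h, of "\<lambda>i. C_set d (b i) \<delta>"] by simp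
  also have "\<dots> = {sum s I | s. \<forall>i\<in>I. s i \<in> C_set d (b i) \<delta>}"
    by (rule set_sum_alt[OF assms(1)])
  also have "\<dots> = {geo_comb (int d ^ \<delta>) I b e | e. True}" (is "?L = ?R")
  proof
    show "?L \<subseteq> ?R"
    proof
      fix x assume "x \<in> ?L"
      then obtain s where x: "x = sum s I" and "\<forall>i\<in>I. \<exists>n. s i = geo (int d ^ \<delta>) n *s b i"
        unfolding C_set_eq by auto
      then obtain e where "\<forall>i\<in>I. s i = geo (int d ^ \<delta>) (e i) *s b i" by metis
      then show "x \<in> ?R" unfolding x geo_comb_def by (intro CollectI exI[of _ e]) simp
    qed
    show "?R \<subseteq> ?L" unfolding C_set_eq geo_comb_def by blast
  qed
  finally have "free_geo_set (int d ^ \<delta>) I c b = (+) c ` (\<Sum>i<card I. C_set d ((b \<circ> h) i) \<delta>)"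
    unfolding geo_set_def by auto
  then show ?thesis
    unfolding translated_C_sums_def using assms(2)
    by (intro CollectI exI[of _ c] exI[of _ "card I"] exI[of _ "b \<circ> h"] exI[of _ "\<lambda>_. \<delta>"]) simp
qed

text \<open>The inductive definition has no clause for the empty set; it arises as
  \<open>X \<inter> - X\<close> from any member.\<close>

lemma boolean_combinations_empty:
  assumes "X \<in> boolean_combinations \<F>"
  shows "{} \<in> boolean_combinations \<F>"
  using boolean_combinations.inter[OF assms boolean_combinations.compl[OF assms]] by simp

lemma boolean_combinations_Union:
  assumes "X \<in> boolean_combinations \<F>" "finite \<V>" "\<V> \<subseteq> boolean_combinations \<F>"
  shows "\<Union>\<V> \<in> boolean_combinations \<F>"
  using assms(2,3) by (induction rule: finite_induct)
    (auto intro: boolean_combinations.union boolean_combinations_empty[OF assms(1)])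

text \<open>Induction on the rank \<open>card I\<close>. In rank 0 every exponent vector is generic
  and \<open>W\<close> below is empty, so no separate base case arises.\<close>

lemma tame_subset_free_geo_set:
  fixes B :: "(int ^ 'm) set"
  assumes q: "q = int d ^ \<delta>" "q \<ge> 2" and "\<delta> > 0"
    and "finite I" "tame q B" "B \<subseteq> free_geo_set q I c b"
  shows "B \<in> boolean_combinations (translated_C_sums d)"
  using assms(4-)
proof (induction "card I" arbitrary: I B c b rule: less_induct)
  case less
  let ?V = "free_geo_set q I c b"
  let ?BC = "boolean_combinations (translated_C_sums d) :: (int ^ 'm) set set"
  have V: "?V \<in> ?BC"
    using free_geo_set_in_translated_C_sums[OF less.prems(1) \<open>\<delta> > 0\<close>] unfolding q(1)
    by (rule boolean_combinations.base)
  obtain M where M: "\<forall>e e'. generic M I e \<longrightarrow> generic M I e' \<longrightarrow>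
      (c + geo_comb q I b e \<in> B \<longleftrightarrow> c + geo_comb q I b e' \<in> B)"
    using less.prems(2)[unfolded tame_def, rule_format, OF less.prems(1), of c b] ..
  \<comment> \<open>The first family fixes an exponent \<open>t < M\<close>, the second merges two
    exponents at distance \<open>t < M\<close>. These are the two ways to violate
    \<open>generic M\<close>.\<close>
  define W where "W = (\<lambda>(i, t). free_geo_set q (I - {i}) (c + geo q t *s b i) b) ` (I \<times> {..<M}) \<union>
    (\<lambda>(i, j, t). free_geo_set q (I - {j}) (c + (geo q t - q ^ t) *s b j) (b(i := b i + q ^ t *s b j)))
      ` (I \<times> I \<times> {..<M})"
  have finW: "finite W" unfolding W_def using less.prems(1) by blast
  have special: "c + geo_comb q I b e \<in> \<Union>W" if "\<not> generic M I e" for e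
  proof -
    have "(\<exists>i\<in>I. e i < M) \<or> (\<exists>i\<in>I. \<exists>j\<in>I. i \<noteq> j \<and> e i \<le> e j \<and> e j < e i + M)"
      using that unfolding generic_def by (metis nat_le_linear not_le order_le_less_trans trans_le_add1)
    then show ?thesis
    proof (elim disjE bexE conjE)
      fix i assume i: "i \<in> I" "e i < M"
      then have "c + geo_comb q I b e = (c + geo q (e i) *s b i) + geo_comb q (I - {i}) b e"
        using geo_comb_remove[OF less.prems(1)] by (simp add: add.assoc)
      then have "c + geo_comb q I b e \<in> free_geo_set q (I - {i}) (c + geo q (e i) *s b i) b"
        unfolding geo_set_def by blast
      then show ?thesis unfolding W_def using i by force
    next
      fix i j assume ij: "i \<in> I" "j \<in> I" "i \<noteq> j" "e i \<le> e j" "e j < e i + M"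
      define t where "t = e j - e i"
      have t: "e j = e i + t" "t < M" using ij by (auto simp: t_def)
      have "q \<noteq> 1" using q(2) by simp
      from geo_comb_merge[OF this less.prems(1) ij(1-3) t(1)]
      have "c + geo_comb q I b e \<in>
          free_geo_set q (I - {j}) (c + (geo q t - q ^ t) *s b j) (b(i := b i + q ^ t *s b j))"
        unfolding geo_set_def by blast
      then show ?thesis unfolding W_def using ij t by force
    qed
  qed
  \<comment> \<open>The traces of \<open>D\<close> on the members of \<open>W\<close> are tame and
    of smaller rank, so the induction hypothesis covers them; \<open>D\<close> is their finite
    union.\<close>
  have small: "D \<in> ?BC" if D: "tame q D" "D \<subseteq> \<Union>W" for D
  proof -
    have "D \<inter> X \<in> ?BC" if "X \<in> W" for X
    proof -
      have "\<exists>k\<in>I. \<exists>c' b'. X = free_geo_set q (I - {k}) c' b'"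
        using that unfolding W_def
      proof (elim UnE imageE)
        fix p assume "p \<in> I \<times> {..<M}" "X = (\<lambda>(i, t). free_geo_set q (I - {i}) (c + geo q t *s b i) b) p"
        then show ?thesis by (intro bexI[of _ "fst p"] exI) (auto simp: split_def)
      next
        fix p assume "p \<in> I \<times> I \<times> {..<M}" "X = (\<lambda>(i, j, t). free_geo_set q (I - {j})
          (c + (geo q t - q ^ t) *s b j) (b(i := b i + q ^ t *s b j))) p"
        then show ?thesis by (intro bexI[of _ "fst (snd p)"] exI) (auto simp: split_def)
      qed
      then obtain k c' b' where k: "k \<in> I" and X: "X = free_geo_set q (I - {k}) c' b'"
        by blast
      have "card (I - {k}) < card I" using k less.prems(1) by (intro psubset_card_mono) auto
      moreover have "tame q (D \<inter> X)"
        unfolding X using less.prems(1) by (intro tame_Int D tame_free_geo_set q) auto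
      ultimately show ?thesis
        using less.hyps[of "I - {k}" "D \<inter> X" c' b'] less.prems(1) X by auto
    qed
    then have "\<Union>((\<inter>) D ` W) \<in> ?BC"
      using boolean_combinations_Union[OF V] finW by blast
    moreover have "D = \<Union>((\<inter>) D ` W)" using D(2) by auto
    ultimately show ?thesis by simp
  qed
  show ?case
  proof (cases "\<exists>e. generic M I e \<and> c + geo_comb q I b e \<in> B")
    case True
    then have all: "c + geo_comb q I b e \<in> B" if "generic M I e" for e using M that by blast
    \<comment> \<open>All generic sums lie in \<open>B\<close>, so its complement in
      \<open>?V\<close> is exceptional; \<open>B\<close> is recovered by removing that complement
      from \<open>?V\<close>.\<close>
    have "?V \<inter> - B \<subseteq> \<Union>W"
    proof
      fix x assume "x \<in> ?V \<inter> - B"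
      then obtain e where "x = c + geo_comb q I b e" "x \<notin> B" unfolding geo_set_def by blast
      then show "x \<in> \<Union>W" using special[of e] all[of e] by blast
    qed
    moreover have "tame q (?V \<inter> - B)"
      using less.prems by (intro tame_Int tame_Compl tame_free_geo_set q)
    ultimately have "?V \<inter> - B \<in> ?BC" using small by blast
    then have "?V \<inter> - (?V \<inter> - B) \<in> ?BC"
      by (rule boolean_combinations.inter[OF V boolean_combinations.compl])
    moreover have "?V \<inter> - (?V \<inter> - B) = B" using less.prems(3) by blast
    ultimately show ?thesis by (simp only:)
  next
    case False
    have "B \<subseteq> \<Union>W"
    proof
      fix x assume "x \<in> B"
      then obtain e where "x = c + geo_comb q I b e" "x \<in> B"
        using less.prems(3) unfolding geo_set_def by blast
      then show "x \<in> \<Union>W" using special[of e] False by blast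
    qed
    then show ?thesis using small less.prems by blast
  qed
qed

subsection \<open>Stability removes the dependence on the order of the exponents\<close>

text \<open>\<open>lo\<close> stands for the exponent preceding the list. With \<open>lo = 0\<close>
  the first entry is at least \<open>M\<close>, which matches the lower bound in
  \<open>generic\<close>.\<close>

fun gapped :: "nat \<Rightarrow> nat \<Rightarrow> nat list \<Rightarrow> bool" where
  "gapped M lo [] \<longleftrightarrow> True"
| "gapped M lo (e # es) \<longleftrightarrow> lo + M \<le> e \<and> gapped M e es"

lemma gapped_mono: "\<lbrakk>gapped M lo es; N \<le> M; lo' \<le> lo\<rbrakk> \<Longrightarrow> gapped N lo' es"
  by (induction es arbitrary: lo lo') fastforce+

lemma gapped_imp_ge: "\<lbrakk>gapped M lo es; e \<in> set es\<rbrakk> \<Longrightarrow> lo + M \<le> e"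
  by (induction es arbitrary: lo) fastforce+

lemma gapped_map_add: "gapped M lo es \<Longrightarrow> gapped M (lo + k) (map (\<lambda>e. e + k) es)"
  by (induction es arbitrary: lo) auto

lemma gapped_append:
  "\<lbrakk>gapped M lo es; \<And>e. e \<in> set es \<Longrightarrow> e \<le> lo'; lo \<le> lo'; gapped M lo' fs\<rbrakk> \<Longrightarrow> gapped M lo (es @ fs)"
  by (induction es arbitrary: lo) (auto intro: gapped_mono)

definition equispaced :: "nat \<Rightarrow> nat \<Rightarrow> nat \<Rightarrow> nat list" where
  "equispaced M lo n = map (\<lambda>k. lo + M * Suc k) [0..<n]"

lemma length_equispaced [simp]: "length (equispaced M lo n) = n"
  by (simp add: equispaced_def)

lemma equispaced_le: "e \<in> set (equispaced M lo n) \<Longrightarrow> e \<le> lo + M * n"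
  by (auto simp: equispaced_def simp del: mult_Suc_right)

lemma gapped_equispaced: "gapped M lo (equispaced M lo n)"
proof (induction n)
  case (Suc n)
  have "equispaced M lo (Suc n) = equispaced M lo n @ [lo + M * n + M]"
    by (simp add: equispaced_def)
  then show ?case using Suc by (auto intro!: gapped_append[where lo' = "lo + M * n"] dest: equispaced_le)
qed (simp add: equispaced_def)

text \<open>Along an increasing list of exponents, the order of \<open>bs\<close> records which
  coefficient receives the smaller exponent. A change of order thus becomes a permutation of
  \<open>bs\<close>.\<close>

definition list_comb :: "int \<Rightarrow> (int ^ 'm) list \<Rightarrow> nat list \<Rightarrow> int ^ 'm" where
  "list_comb q bs es = sum_list (map2 (\<lambda>b e. geo q e *s b) bs es)"

lemma list_comb_Nil [simp]: "list_comb q [] es = 0"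
  by (simp add: list_comb_def)

lemma list_comb_Cons [simp]: "list_comb q (b # bs) (e # es) = geo q e *s b + list_comb q bs es"
  by (simp add: list_comb_def)

lemma list_comb_append:
  "length bs = length es \<Longrightarrow> list_comb q (bs @ bs') (es @ es') = list_comb q bs es + list_comb q bs' es'"
  by (simp add: list_comb_def)

lemma list_comb_eq_geo_comb:
  "length es = length bs \<Longrightarrow> list_comb q bs es = geo_comb q {..<length bs} ((!) bs) ((!) es)"
  unfolding list_comb_def geo_comb_def by (simp add: sum_list_sum_nth atLeast0LessThan)

lemma geo_comb_eq_list_comb:
  "distinct is \<Longrightarrow> geo_comb q (set is) b e = list_comb q (map b is) (map e is)"
  unfolding geo_comb_def by (induction "is") auto

text \<open>Two gapped lists are made equal from the left: at each stage the remaining parts are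
  raised until their heads coincide, which stretchability allows.\<close>

lemma stretchable_gapped:
  assumes "stretchable q A"
  shows "\<exists>M. \<forall>es es'. length es = length bs \<longrightarrow> length es' = length bs \<longrightarrow> gapped M 0 es \<longrightarrow> gapped M 0 es' \<longrightarrow>
    (c + list_comb q bs es \<in> A \<longleftrightarrow> c + list_comb q bs es' \<in> A)"
proof -
  obtain M where M: "\<forall>e t \<Delta>. (\<forall>i\<in>{..<length bs}. e i < t \<or> t + M \<le> e i) \<longrightarrow>
     (c + geo_comb q {..<length bs} ((!) bs) (\<lambda>i. if t \<le> e i then e i + \<Delta> else e i) \<in> A \<longleftrightarrow>
      c + geo_comb q {..<length bs} ((!) bs) e \<in> A)"
    using assms[unfolded stretchable_def, rule_format, of "{..<length bs}" c "(!) bs", OF finite_lessThan] ..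
  \<comment> \<open>The cut is at \<open>Suc lo\<close> because the prefix may contain
    \<open>lo\<close> itself; hence the gap \<open>Suc M\<close> instead of
    \<open>M\<close>.\<close>
  have shift: "c + list_comb q bs (pre @ map (\<lambda>e. e + \<Delta>) es) \<in> A \<longleftrightarrow> c + list_comb q bs (pre @ es) \<in> A"
    if "length (pre @ es) = length bs" "\<And>e. e \<in> set pre \<Longrightarrow> e \<le> lo" "gapped (Suc M) lo es" for pre es lo \<Delta>
  proof -
    define xs where "xs = pre @ es"
    have len: "length xs = length bs" using that(1) by (simp add: xs_def)
    have "e < Suc lo \<or> Suc lo + M \<le> e" if "e \<in> set xs" for e
      using that \<open>\<And>e. e \<in> set pre \<Longrightarrow> e \<le> lo\<close> gapped_imp_ge[OF \<open>gapped (Suc M) lo es\<close>, of e]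
      by (fastforce simp: xs_def)
    then have 1: "c + geo_comb q {..<length bs} ((!) bs) (\<lambda>i. if Suc lo \<le> xs ! i then xs ! i + \<Delta> else xs ! i) \<in> A \<longleftrightarrow>
      c + geo_comb q {..<length bs} ((!) bs) ((!) xs) \<in> A"
      using M[rule_format, of "(!) xs" "Suc lo" \<Delta>] len by simp
    have 2: "pre @ map (\<lambda>e. e + \<Delta>) es = map (\<lambda>e. if Suc lo \<le> e then e + \<Delta> else e) xs"
    proof -
      have "map (\<lambda>e. if Suc lo \<le> e then e + \<Delta> else e) pre = pre"
        using that(2) by (intro map_idI) fastforce
      moreover have "map (\<lambda>e. if Suc lo \<le> e then e + \<Delta> else e) es = map (\<lambda>e. e + \<Delta>) es"
        using gapped_imp_ge[OF that(3)] by (intro map_cong) fastforce+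
      ultimately show ?thesis unfolding xs_def by simp
    qed
    have 3: "geo_comb q {..<length bs} ((!) bs) (\<lambda>i. if Suc lo \<le> xs ! i then xs ! i + \<Delta> else xs ! i) =
        list_comb q bs (map (\<lambda>e. if Suc lo \<le> e then e + \<Delta> else e) xs)"
      using len by (simp add: list_comb_eq_geo_comb cong: geo_comb_cong) (intro geo_comb_cong, auto)
    show ?thesis
      unfolding 2 xs_def[symmetric] list_comb_eq_geo_comb[OF len] using 1 unfolding 3 .
  qed
  have "c + list_comb q bs (pre @ es) \<in> A \<longleftrightarrow> c + list_comb q bs (pre @ es') \<in> A"
    if "length (pre @ es) = length bs" "length es = length es'" "\<And>e. e \<in> set pre \<Longrightarrow> e \<le> lo"
      "gapped (Suc M) lo es" "gapped (Suc M) lo es'" for pre es es' lo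
    using that
  proof (induction "length es" arbitrary: pre es es' lo)
    case (Suc n)
    obtain e r where es: "es = e # r" using Suc.hyps(2) by (cases es) auto
    obtain e' r' where es': "es' = e' # r'" using Suc.hyps(2) Suc.prems(2) by (cases es') auto
    \<comment> \<open>Raising each list by the head of the other gives both the head
      \<open>e + e'\<close>, which then joins the prefix.\<close>
    have "c + list_comb q bs (pre @ es) \<in> A \<longleftrightarrow> c + list_comb q bs (pre @ map (\<lambda>x. x + e') es) \<in> A"
      by (rule shift[symmetric, OF Suc.prems(1,3,4)])
    also have "\<dots> \<longleftrightarrow> c + list_comb q bs ((pre @ [e + e']) @ map (\<lambda>x. x + e') r) \<in> A"
      by (simp add: es)
    also have "\<dots> \<longleftrightarrow> c + list_comb q bs ((pre @ [e + e']) @ map (\<lambda>x. x + e) r') \<in> A"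
    proof (rule Suc.hyps(1))
      show "x \<le> e + e'" if "x \<in> set (pre @ [e + e'])" for x
        using that Suc.prems(3)[of x] Suc.prems(4) unfolding es by auto
      show "gapped (Suc M) (e + e') (map (\<lambda>x. x + e') r)"
        using Suc.prems(4) gapped_map_add unfolding es by simp
      show "gapped (Suc M) (e + e') (map (\<lambda>x. x + e) r')"
        using Suc.prems(5) gapped_map_add[of "Suc M" e' r' e] unfolding es' by (simp add: add.commute)
    qed (use Suc.prems Suc.hyps in \<open>auto simp: es es'\<close>)
    also have "\<dots> \<longleftrightarrow> c + list_comb q bs (pre @ map (\<lambda>x. x + e) es') \<in> A"
      by (simp add: es' add.commute)
    also have "\<dots> \<longleftrightarrow> c + list_comb q bs (pre @ es') \<in> A"
      by (rule shift[OF _ Suc.prems(3,5)]) (use Suc.prems(1,2) in simp_all)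
    finally show ?case .
  qed simp
  note * = this[of "[]" _ _ 0, simplified]
  show ?thesis by (intro exI[of _ "Suc M"] allI impI *) simp_all
qed

definition eventually_in :: "int \<Rightarrow> (int ^ 'm) set \<Rightarrow> int ^ 'm \<Rightarrow> (int ^ 'm) list \<Rightarrow> bool" where
  "eventually_in q A c bs \<longleftrightarrow>
     (\<exists>M. \<forall>es. length es = length bs \<longrightarrow> gapped M 0 es \<longrightarrow> c + list_comb q bs es \<in> A)"

lemma stretchable_eventually_in:
  assumes "stretchable q A"
  shows "\<exists>M. \<forall>es. length es = length bs \<longrightarrow> gapped M 0 es \<longrightarrow>
    (c + list_comb q bs es \<in> A \<longleftrightarrow> eventually_in q A c bs)"
proof -
  obtain M where M: "\<forall>es es'. length es = length bs \<longrightarrow> length es' = length bs \<longrightarrow>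
      gapped M 0 es \<longrightarrow> gapped M 0 es' \<longrightarrow>
      (c + list_comb q bs es \<in> A \<longleftrightarrow> c + list_comb q bs es' \<in> A)"
    using stretchable_gapped[OF assms] ..
  have "c + list_comb q bs es \<in> A \<longleftrightarrow> eventually_in q A c bs"
    if es: "length es = length bs" "gapped M 0 es" for es
  proof
    assume "c + list_comb q bs es \<in> A"
    then show "eventually_in q A c bs"
      unfolding eventually_in_def using M es by blast
  next
    assume "eventually_in q A c bs"
    then obtain N where N: "\<forall>es. length es = length bs \<longrightarrow> gapped N 0 es \<longrightarrow> c + list_comb q bs es \<in> A"
      unfolding eventually_in_def ..
    \<comment> \<open>A list with gap \<open>M + N\<close> links the uniform threshold
      \<open>M\<close> to the unknown threshold \<open>N\<close> from
      \<open>eventually_in\<close>.\<close>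
    define fs where "fs = equispaced (M + N) 0 (length bs)"
    have "gapped (M + N) 0 fs" "length fs = length bs" by (simp_all add: fs_def gapped_equispaced)
    then have "c + list_comb q bs fs \<in> A" "gapped M 0 fs"
      using N gapped_mono[of "M + N" 0 fs N 0] gapped_mono[of "M + N" 0 fs M 0] by auto
    then show "c + list_comb q bs es \<in> A" using M es \<open>length fs = length bs\<close> by blast
  qed
  then show ?thesis by blast
qed

text \<open>If the two orders of \<open>a\<close> and \<open>b\<close> behaved differently, giving
  \<open>a\<close> the exponent \<open>\<alpha> i\<close> and \<open>b\<close> the exponent
  \<open>\<beta> j\<close> from interlaced sequences would make membership equivalent to
  \<open>i \<le> j\<close>: a ladder of any length.\<close>

lemma eventually_in_swap:
  assumes "stretchable q A" "stable_in_group A" "eventually_in q A c (xs @ a # b # ys)"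
  shows "eventually_in q A c (xs @ b # a # ys)"
proof (rule ccontr)
  assume not: "\<not> eventually_in q A c (xs @ b # a # ys)"
  let ?n = "length (xs @ a # b # ys)"
  obtain M1 where M1: "\<forall>es. length es = ?n \<longrightarrow> gapped M1 0 es \<longrightarrow> c + list_comb q (xs @ a # b # ys) es \<in> A"
    using assms(3) unfolding eventually_in_def ..
  obtain M2 where M2: "\<forall>es. length es = length (xs @ b # a # ys) \<longrightarrow> gapped M2 0 es \<longrightarrow>
      (c + list_comb q (xs @ b # a # ys) es \<in> A \<longleftrightarrow> eventually_in q A c (xs @ b # a # ys))"
    using stretchable_eventually_in[OF assms(1)] ..
  define M where "M = M1 + M2"
  obtain N where N: "\<not> (\<exists>a b. is_ladder N {(x, y). x + y \<in> A} a b)"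
    using assms(2) unfolding stable_in_group_def stable_relation_def ..
  \<comment> \<open>\<open>xs\<close> takes exponents up to \<open>l1\<close> and \<open>ys\<close>
    those beyond \<open>l2 = \<beta> N\<close>. In between, neighbours in the sequence
    \<open>\<alpha> 0\<close>, \<open>\<beta> 0\<close>, \<open>\<alpha> 1\<close>,
    \<open>\<beta> 1\<close>, ... are \<open>M\<close> apart.\<close>
  define l1 where "l1 = M * length xs"
  define l2 where "l2 = l1 + 2 * M + 2 * (M * N)"
  define \<alpha> where "\<alpha> = (\<lambda>i. l1 + M + 2 * (M * i))"
  define \<beta> where "\<beta> = (\<lambda>j. l1 + 2 * M + 2 * (M * j))"
  define es where "es = equispaced M 0 (length xs)"
  define fs where "fs = equispaced M l2 (length ys)"
  have gap: "gapped M 0 (es @ s # t # fs)" if "l1 + M \<le> s" "s + M \<le> t" "t \<le> l2" for s t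
  proof -
    have "gapped M 0 es" "\<And>e. e \<in> set es \<Longrightarrow> e \<le> l1"
      unfolding es_def l1_def using equispaced_le gapped_equispaced by fastforce+
    moreover have "gapped M t fs"
      using that(3) gapped_mono[OF gapped_equispaced[of M l2], of M t] by (simp add: fs_def)
    ultimately show ?thesis using that by (intro gapped_append[where lo' = l1]) auto
  qed
  define X where "X = (\<lambda>i. c + list_comb q xs es + geo q (\<alpha> i) *s a + list_comb q ys fs)"
  define Y where "Y = (\<lambda>j. geo q (\<beta> j) *s b)"
  \<comment> \<open>The same vector is read in both orders; the comparison of \<open>i\<close> and
    \<open>j\<close> decides which reading is gapped.\<close>
  have XY: "X i + Y j = c + list_comb q (xs @ a # b # ys) (es @ \<alpha> i # \<beta> j # fs)"
    "X i + Y j = c + list_comb q (xs @ b # a # ys) (es @ \<beta> j # \<alpha> i # fs)" for i j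
    by (simp_all add: X_def Y_def list_comb_append es_def fs_def algebra_simps)
  have "X i + Y j \<in> A \<longleftrightarrow> i \<le> j" if "i \<le> N" "j \<le> N" for i j
  proof (cases "i \<le> j")
    case True
    have "M * i \<le> M * j" "M * j \<le> M * N" using True that by (auto intro: mult_le_mono2)
    then have "gapped M 0 (es @ \<alpha> i # \<beta> j # fs)"
      by (intro gap; unfold \<alpha>_def \<beta>_def l2_def; linarith)
    then have "gapped M1 0 (es @ \<alpha> i # \<beta> j # fs)" by (rule gapped_mono) (simp_all add: M_def)
    then show ?thesis unfolding XY(1) using M1 True by (auto simp: es_def fs_def)
  next
    case False
    have "M * j + M \<le> M * i" "M * i \<le> M * N"
      using False that mult_le_mono2[of "Suc j" i M] by auto
    then have "gapped M 0 (es @ \<beta> j # \<alpha> i # fs)"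
      by (intro gap; unfold \<alpha>_def \<beta>_def l2_def; linarith)
    then have "gapped M2 0 (es @ \<beta> j # \<alpha> i # fs)" by (rule gapped_mono) (simp_all add: M_def)
    then show ?thesis unfolding XY(2) using M2 not False by (auto simp: es_def fs_def)
  qed
  then have "is_ladder N {(x, y). x + y \<in> A} X Y" unfolding is_ladder_def by simp
  then show False using N by blast
qed

text \<open>Adjacent swaps generate all permutations. The prefix \<open>pre\<close> lets the
  induction work behind coefficients already placed.\<close>

lemma eventually_in_mset:
  assumes "stretchable q A" "stable_in_group A"
  shows "\<lbrakk>mset xs = mset ys; eventually_in q A c (pre @ xs)\<rbrakk> \<Longrightarrow> eventually_in q A c (pre @ ys)"
proof (induction xs arbitrary: pre ys)
  case (Cons x xs)
  have "x \<in> set ys" using mset_eq_setD[OF Cons.prems(1)] by auto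
  then obtain us vs where ys: "ys = us @ x # vs" by (meson split_list)
  have "mset xs = mset (us @ vs)" using Cons.prems(1) ys by simp
  then have "eventually_in q A c ((pre @ [x]) @ us @ vs)" 
    using Cons.IH[of "us @ vs" "pre @ [x]"] Cons.prems(2) by simp
  then have "eventually_in q A c (pre @ x # us @ vs)" by simp
  then have "eventually_in q A c (pre @ us @ x # vs)"
  proof (induction us arbitrary: pre)
    case (Cons u us)
    have "eventually_in q A c (pre @ u # x # us @ vs)"
      using eventually_in_swap[OF assms] Cons.prems by simp
    then show ?case using Cons.IH[of "pre @ [u]"] by simp
  qed simp
  then show ?case using ys by simp
qed simp

lemma gapped_map_sorted:
  assumes "generic M (set is) e" "distinct is" "sorted (map e is)" "\<And>i. i \<in> set is \<Longrightarrow> lo + M \<le> e i"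
  shows "gapped M lo (map e is)"
  using assms
proof (induction "is" arbitrary: lo)
  case (Cons i "is")
  have "e i + M \<le> e j" if "j \<in> set is" for j
  proof -
    have "e i \<le> e j" "i \<noteq> j" using that Cons.prems by auto
    moreover have "e i + M \<le> e j \<or> e j + M \<le> e i"
      using Cons.prems(1) that \<open>i \<noteq> j\<close> unfolding generic_def by auto
    ultimately show ?thesis by auto
  qed
  moreover have "generic M (set is) e" using Cons.prems(1) by (auto simp: generic_def)
  ultimately show ?case using Cons by auto
qed simp

text \<open>Sorting the indices by exponent turns a generic sum into one over a gapped list.
  Different exponents only permute the coefficients, and by stability this does not matter.\<close>

lemma tame_if_stable:
  fixes A :: "(int ^ 'm) set"
  assumes "stretchable q A" "stable_in_group A"
  shows "tame q A"
  unfolding tame_def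
proof (intro allI impI)
  fix c and b :: "nat \<Rightarrow> int ^ 'm" and I :: "nat set" assume I: "finite I"
  have "\<forall>bs. \<exists>M. \<forall>es. length es = length bs \<longrightarrow> gapped M 0 es \<longrightarrow>
      (c + list_comb q bs es \<in> A \<longleftrightarrow> eventually_in q A c bs)"
    using stretchable_eventually_in[OF assms(1)] by blast
  from choice[OF this] obtain m where m: "\<forall>bs es. length es = length bs \<longrightarrow> gapped (m bs) 0 es \<longrightarrow>
      (c + list_comb q bs es \<in> A \<longleftrightarrow> eventually_in q A c bs)"
    by blast
  \<comment> \<open>Every ordering of \<open>I\<close> belongs to the finite set \<open>S\<close>,
    so the sum of the thresholds over \<open>S\<close> bounds each of them.\<close>
  define S where "S = {is. set is \<subseteq> I \<and> distinct is}"
  define M where "M = (\<Sum>is\<in>S. m (map b is))"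
  have "finite S" unfolding S_def using I by (rule finite_subset_distinct)
  have "c + geo_comb q I b e \<in> A \<longleftrightarrow> eventually_in q A c (map b (sorted_list_of_set I))"
    if "generic M I e" for e
  proof -
    define "is" where "is = sort_key e (sorted_list_of_set I)"
    have "is": "set is = I" "distinct is" "sorted (map e is)" "mset is = mset (sorted_list_of_set I)"
      using I by (simp_all add: is_def)
    have "is \<in> S" using "is" by (simp add: S_def)
    then have "m (map b is) \<le> M" unfolding M_def
      using \<open>finite S\<close> by (intro member_le_sum[where f = "\<lambda>is. m (map b is)"]) auto
    moreover have "gapped M 0 (map e is)"
      using that "is" by (intro gapped_map_sorted) (auto simp: generic_def)
    ultimately have "gapped (m (map b is)) 0 (map e is)" by (auto intro: gapped_mono)
    then have "c + list_comb q (map b is) (map e is) \<in> A \<longleftrightarrow> eventually_in q A c (map b is)"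
      using m by simp
    moreover have "mset (map b is) = mset (map b (sorted_list_of_set I))"
      using "is"(4) by (metis mset_map)
    then have "eventually_in q A c (map b is) \<longleftrightarrow> eventually_in q A c (map b (sorted_list_of_set I))"
      using eventually_in_mset[OF assms, where pre = "[]"] by (metis append_Nil)
    moreover have "geo_comb q I b e = list_comb q (map b is) (map e is)"
      using geo_comb_eq_list_comb[OF "is"(2), of q b e] "is"(1) by simp
    ultimately show ?thesis by simp
  qed
  then show "\<exists>M. \<forall>e e'. generic M I e \<longrightarrow> generic M I e' \<longrightarrow>
     (c + geo_comb q I b e \<in> A \<longleftrightarrow> c + geo_comb q I b e' \<in> A)" by blast
qed

subsection \<open>Finite unions of ordered sets\<close>

definition geo_union :: "int \<Rightarrow> (int ^ 'm) set \<Rightarrow> bool" where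
  "geo_union q S \<longleftrightarrow>
     (\<exists>\<V>. finite \<V> \<and> (\<forall>V\<in>\<V>. \<exists>r c a. V = descending_geo_set q r c a) \<and> S = \<Union>\<V>)"

lemma geo_union_descending: "geo_union q (descending_geo_set q r c a)"
  unfolding geo_union_def by (intro exI[of _ "{descending_geo_set q r c a}"]) auto

lemma geo_union_empty: "geo_union q {}"
  unfolding geo_union_def by (intro exI[of _ "{}"]) auto

lemma geo_union_singleton:
  fixes x :: "int ^ 'm"
  shows "geo_union q {x}"
proof -
  have "descending_geo_set q 0 x a = {x}" for a :: "nat \<Rightarrow> int ^ 'm"
    by (simp add: geo_set_def geo_comb_def)
  then show ?thesis by (metis geo_union_descending)
qed

lemma geo_union_Un: "\<lbrakk>geo_union q S; geo_union q T\<rbrakk> \<Longrightarrow> geo_union q (S \<union> T)"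
  unfolding geo_union_def
proof (elim exE conjE)
  fix \<V> \<W> assume "finite \<V>" "\<forall>V\<in>\<V>. \<exists>r c a. V = descending_geo_set q r c a" "S = \<Union>\<V>"
    "finite \<W>" "\<forall>V\<in>\<W>. \<exists>r c a. V = descending_geo_set q r c a" "T = \<Union>\<W>"
  then show "\<exists>\<V>. finite \<V> \<and> (\<forall>V\<in>\<V>. \<exists>r c a. V = descending_geo_set q r c a) \<and> S \<union> T = \<Union>\<V>"
    by (intro exI[of _ "\<V> \<union> \<W>"]) blast
qed

lemma geo_union_UN: "\<lbrakk>finite I; \<And>i. i \<in> I \<Longrightarrow> geo_union q (S i)\<rbrakk> \<Longrightarrow> geo_union q (\<Union>i\<in>I. S i)"
  by (induction rule: finite_induct) (simp_all add: geo_union_empty geo_union_Un)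

lemma geo_union_bind:
  assumes "geo_union q S" "\<And>r c a. geo_union q (\<Union>x\<in>descending_geo_set q r c a. T x)"
  shows "geo_union q (\<Union>x\<in>S. T x)"
proof -
  obtain \<V> where \<V>: "finite \<V>" "\<forall>V\<in>\<V>. \<exists>r c a. V = descending_geo_set q r c a" "S = \<Union>\<V>"
    using assms(1) unfolding geo_union_def by (elim exE conjE)
  have "geo_union q (\<Union>V\<in>\<V>. \<Union>x\<in>V. T x)"
    by (rule geo_union_UN[OF \<V>(1)]) (use \<V>(2) assms(2) in auto)
  moreover have "(\<Union>V\<in>\<V>. \<Union>x\<in>V. T x) = (\<Union>x\<in>S. T x)" using \<V>(3) by auto
  ultimately show ?thesis by simp
qed

lemma geo_union_affine:
  fixes S :: "(int ^ 'm) set"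
  assumes "geo_union q S"
  shows "geo_union q ((\<lambda>x. v + k *s x) ` S)"
proof -
  have "geo_union q (\<Union>x\<in>descending_geo_set q r c a. {v + k *s x})" for r c and a :: "nat \<Rightarrow> int ^ 'm"
  proof -
    have affine: "v + k *s (c + geo_comb q {..<r} a e) = (v + k *s c) + geo_comb q {..<r} (\<lambda>i. k *s a i) e" for e
      unfolding geo_comb_def
      by (simp add: ivec.scale_right_distrib ivec.scale_sum_right mult.commute add.assoc)
    have "(\<Union>x\<in>descending_geo_set q r c a. {v + k *s x}) =
        descending_geo_set q r (v + k *s c) (\<lambda>i. k *s a i)"
      unfolding geo_set_def affine[symmetric] by blast
    then show ?thesis by (simp add: geo_union_descending)
  qed
  from geo_union_bind[OF assms this] have "geo_union q (\<Union>x\<in>S. {v + k *s x})" .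
  moreover have "(\<Union>x\<in>S. {v + k *s x}) = (\<lambda>x. v + k *s x) ` S" by auto
  ultimately show ?thesis by (simp only:)
qed

text \<open>\<open>Suc k\<close> iterations collect the \<open>k + 1\<close> powers in
  \<open>geo q k\<close>; zero iterations do not have this form and are treated separately
  later.\<close>

lemma affine_funpow:
  fixes v x :: "int ^ 'm"
  assumes "q \<noteq> 1"
  shows "((\<lambda>x. v + q *s x) ^^ Suc k) x = geo q k *s v + q ^ Suc k *s x"
proof (induction k)
  case (Suc k)
  have "geo q (Suc k) = 1 + q * geo q k" using geo_Suc_add[OF assms, of k 0] by simp
  then have "geo q (Suc k) *s v + q ^ Suc (Suc k) *s x = v + q *s (geo q k *s v + q ^ Suc k *s x)"
    by (simp add: ivec.scale_left_distrib ivec.scale_right_distrib)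
  then show ?case using Suc by simp
qed simp

text \<open>Zero pumps give back an ordered set; one or more pumps give an ordered set of rank one
  higher, because the number of pumps provides a new exponent.\<close>

lemma geo_union_funpow:
  fixes S :: "(int ^ 'm) set"
  assumes q: "q \<noteq> 1" and "geo_union q S"
  shows "geo_union q (\<Union>x\<in>S. range (\<lambda>k. ((\<lambda>x. v + q *s x) ^^ k) x))"
proof (rule geo_union_bind[OF assms(2)])
  fix r c and a :: "nat \<Rightarrow> int ^ 'm"
  let ?f = "\<lambda>x. v + q *s x"
  let ?V = "descending_geo_set q r c a"
  \<comment> \<open>The coefficient of \<open>geo q k\<close> collects \<open>v\<close>, the excess
    \<open>(q - 1) *s c\<close> from scaling the constant, and a correction \<open>- a i\<close>
    from each old term.\<close>
  define a' where "a' = a(r := v + (q - 1) *s c - sum a {..<r})"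
  \<comment> \<open>\<open>k + 1\<close> pumps push the old exponents above \<open>k\<close>, which becomes the new smallest exponent\<close>
  have step: "(?f ^^ Suc k) (c + geo_comb q {..<r} a e) =
      c + geo_comb q {..<Suc r} a' (\<lambda>i. if i < r then e i + Suc k else k)" for k e
  proof -
    have "q ^ Suc k * geo q (e i) = geo q (e i + Suc k) - geo q k" for i
      using geo_Suc_add[OF q, of "e i" k] by simp
    then have "q ^ Suc k *s geo_comb q {..<r} a e = (\<Sum>i<r. geo q (e i + Suc k) *s a i) - geo q k *s sum a {..<r}"
      unfolding geo_comb_def ivec.scale_sum_right ivec.scale_scale
      by (simp add: ivec.scale_left_diff_distrib sum_subtractf)
    moreover have "q ^ Suc k = 1 + geo q k * (q - 1)"
      using geo_closed_form[of q k] by (simp add: mult.commute)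
    then have "q ^ Suc k *s c = c + geo q k *s ((q - 1) *s c)"
      by (simp only: ivec.scale_left_distrib ivec.scale_scale ivec.scale_one)
    moreover have "geo_comb q {..<Suc r} a' (\<lambda>i. if i < r then e i + Suc k else k) =
        (\<Sum>i<r. geo q (e i + Suc k) *s a i) + geo q k *s (v + (q - 1) *s c - sum a {..<r})"
      unfolding geo_comb_def a'_def by simp
    ultimately show ?thesis
      unfolding affine_funpow[OF q] ivec.scale_right_distrib ivec.scale_right_diff_distrib by simp
  qed
  have "(\<Union>x\<in>?V. range (\<lambda>k. (?f ^^ k) x)) = ?V \<union> descending_geo_set q (Suc r) c a'" (is "?L = ?R")
  proof
    show "?L \<subseteq> ?R"
    proof clarify
      fix x k assume x: "x \<in> ?V" "(?f ^^ k) x \<notin> descending_geo_set q (Suc r) c a'"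
      show "(?f ^^ k) x \<in> ?V"
      proof (cases k)
        case (Suc k')
        obtain e where e: "x = c + geo_comb q {..<r} a e" "\<forall>i\<in>{..<r}. \<forall>j\<in>{..<r}. i < j \<longrightarrow> e j < e i"
          using x(1) unfolding geo_set_def by blast
        have "(?f ^^ k) x \<in> descending_geo_set q (Suc r) c a'"
          unfolding e(1) Suc step unfolding geo_set_def
          by (intro CollectI exI[of _ "\<lambda>i. if i < r then e i + Suc k' else k'"]) (use e(2) in auto)
        then show ?thesis using x(2) by blast
      qed (use x in simp)
    qed
    show "?R \<subseteq> ?L"
    proof (intro Un_least subsetI)
      fix x assume "x \<in> ?V"
      then show "x \<in> ?L" by (intro UN_I[of x] range_eqI[of _ _ 0]) auto
    next
      fix x assume "x \<in> descending_geo_set q (Suc r) c a'"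
      then obtain e where e: "x = c + geo_comb q {..<Suc r} a' e"
        and ord: "\<And>i j. i < Suc r \<Longrightarrow> j < Suc r \<Longrightarrow> i < j \<Longrightarrow> e j < e i"
        unfolding geo_set_def by blast
      \<comment> \<open>Undoes the shift. The exponents descend, so \<open>e r\<close> is the
        smallest and the subtraction is exact.\<close>
      define f where "f = (\<lambda>i. e i - Suc (e r))"
      have f: "e i = f i + Suc (e r)" if "i < r" for i using ord[of i r] that by (simp add: f_def)
      have "x = (?f ^^ Suc (e r)) (c + geo_comb q {..<r} a f)"
        unfolding step e using f by (intro arg_cong2[of _ _ _ _ "(+)"] geo_comb_cong) (auto simp: less_Suc_eq)
      moreover have "c + geo_comb q {..<r} a f \<in> ?V"
      proof -
        have "f j < f i" if "i < r" "j < r" "i < j" for i j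
          using ord[of i j] f[of i] f[of j] that by simp
        then show ?thesis unfolding geo_set_def by blast
      qed
      ultimately show "x \<in> ?L" by blast
    qed
  qed
  then show "geo_union q (\<Union>x\<in>?V. range (\<lambda>k. (?f ^^ k) x))"
    by (simp add: geo_union_Un geo_union_descending)
qed

subsection \<open>Words and their values\<close>

primrec word_value :: "int \<Rightarrow> (int ^ 'm) list \<Rightarrow> int ^ 'm" where
  "word_value d [] = 0"
| "word_value d (v # w) = v + d *s word_value d w"

lemma word_value_append: "word_value d (u @ w) = word_value d u + d ^ length u *s word_value d w"
  by (induction u) (simp_all add: ivec.scale_right_distrib add.assoc)

text \<open>On values, pumping a factor \<open>v\<close> iterates one affine map of ratio
  \<open>d ^ length v\<close>, which is the situation of \<open>geo_union_funpow\<close>.\<close>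

lemma word_value_replicate_append:
  "word_value d (concat (replicate k v) @ w) =
     ((\<lambda>x. word_value d v + d ^ length v *s x) ^^ k) (word_value d w)"
  by (induction k) (simp_all add: word_value_append)

lemma word_value_map_upt: "word_value d (map f [0..<n]) = (\<Sum>j<n. d ^ j *s f j)"
  by (induction n) (simp_all add: word_value_append)

text \<open>\<open>n\<close> may exceed the number of digits, as \<open>nth_default\<close> pads
  with 0; this happens in the shorter rows of \<open>vec_canonical\<close>.\<close>

lemma sum_int_canonical:
  assumes "d \<ge> 2" "length (int_canonical d x) \<le> n"
  shows "(\<Sum>j<n. int d ^ j * nth_default 0 (int_canonical d x) j) = x"
proof -
  \<comment> \<open>The sign becomes an arbitrary factor \<open>s\<close>, because the quotient may
    reach 0, where \<open>sgn\<close> would change.\<close>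
  have *: "(\<Sum>j<n. int d ^ j * nth_default 0 (map (\<lambda>k. s * int k) (nat_digits d a)) j) = s * int a"
    if "length (nat_digits d a) \<le> n" for s n a
    using that
  proof (induction a arbitrary: n rule: less_induct)
    case (less a)
    show ?case
    proof (cases "a = 0")
      case True
      then show ?thesis by (simp add: nat_digits.simps[of d 0])
    next
      case False
      then have digits: "nat_digits d a = a mod d # nat_digits d (a div d)"
        using assms(1) by (simp add: nat_digits.simps[of d a])
      then obtain n' where n: "n = Suc n'" using less.prems by (cases n) auto
      have "(\<Sum>j<n'. int d ^ j * nth_default 0 (map (\<lambda>k. s * int k) (nat_digits d (a div d))) j) =
          s * int (a div d)"
        using False assms(1) less.prems digits n by (intro less.IH) (auto intro: div_less_dividend)
      then have "(\<Sum>j<n. int d ^ j * nth_default 0 (map (\<lambda>k. s * int k) (nat_digits d a)) j) =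
          s * int (a mod d) + int d * (s * int (a div d))"
        unfolding n digits by (simp add: sum.lessThan_Suc_shift sum_distrib_left[symmetric] mult.assoc del: sum.lessThan_Suc)
      also have "\<dots> = s * int (a mod d + d * (a div d))" by (simp only: of_nat_add of_nat_mult algebra_simps)
      also have "a mod d + d * (a div d) = a" by simp
      finally show ?thesis .
    qed
  qed
  have "(\<Sum>j<n. int d ^ j * nth_default 0 (int_canonical d x) j) = sgn x * int (nat \<bar>x\<bar>)"
    unfolding int_canonical_def using assms(2) by (intro *) (simp add: int_canonical_def)
  then show ?thesis by (simp add: mult_sgn_abs)
qed

lemma word_value_vec_canonical:
  fixes a :: "int ^ 'm"
  assumes "d \<ge> 2"
  shows "word_value (int d) (vec_canonical d a) = a"
proof (subst vec_eq_iff, rule allI)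
  fix i
  define n where "n = Max (range (\<lambda>i. length (int_canonical d (a $ i))))"
  have "length (int_canonical d (a $ i)) \<le> n" unfolding n_def by (intro Max_ge) auto
  from sum_int_canonical[OF assms this]
  show "word_value (int d) (vec_canonical d a) $ i = a $ i"
    unfolding vec_canonical_def word_value_map_upt n_def[symmetric] by simp
qed

subsection \<open>Sparse languages\<close>

context
  fixes step :: "'s \<Rightarrow> 'a \<Rightarrow> 's" and \<Sigma> :: "'a set"
begin

text \<open>Runs are confined to a state set \<open>P\<close>, both ends included, so that
  inductions can delete one state at a time.\<close>

primrec path :: "'s set \<Rightarrow> 's \<Rightarrow> 'a list \<Rightarrow> bool" where
  "path P p [] \<longleftrightarrow> p \<in> P"
| "path P p (s # w) \<longleftrightarrow> p \<in> P \<and> s \<in> \<Sigma> \<and> path P (step p s) w"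

definition loops :: "'s set \<Rightarrow> 's \<Rightarrow> 'a list set" where
  "loops P p = {w. path P p w \<and> foldl step p w = p}"

definition accepted :: "'s set \<Rightarrow> 's set \<Rightarrow> 's \<Rightarrow> 'a list set" where
  "accepted F P p = {w. path P p w \<and> foldl step p w \<in> F}"

lemma path_append: "path P p (u @ w) \<longleftrightarrow> path P p u \<and> path P (foldl step p u) w"
proof (induction u arbitrary: p)
  case Nil
  then show ?case by (cases w) auto
qed auto

lemma path_start: "path P p w \<Longrightarrow> p \<in> P"
  by (cases w) auto

lemma path_mono: "\<lbrakk>path P p w; P \<subseteq> P'\<rbrakk> \<Longrightarrow> path P' p w"
  by (induction w arbitrary: p) auto

lemma path_lists: "path P p w \<Longrightarrow> w \<in> lists \<Sigma>"
  by (induction w arbitrary: p) auto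

lemma loops_mono: "P \<subseteq> P' \<Longrightarrow> loops P p \<subseteq> loops P' p"
  unfolding loops_def using path_mono by blast

lemma accepted_mono: "P \<subseteq> P' \<Longrightarrow> accepted F P p \<subseteq> accepted F P' p"
  unfolding accepted_def using path_mono by blast

lemma Nil_in_loops: "p \<in> P \<Longrightarrow> [] \<in> loops P p"
  by (simp add: loops_def)

lemma append_in_loops: "x \<in> loops P p \<Longrightarrow> x @ y \<in> loops P p \<longleftrightarrow> y \<in> loops P p"
  by (simp add: loops_def path_append)

lemma concat_in_loops: "\<lbrakk>p \<in> P; set xs \<subseteq> loops P p\<rbrakk> \<Longrightarrow> concat xs \<in> loops P p"
  by (induction xs) (simp_all add: Nil_in_loops append_in_loops)

lemma split_at_last_visit:
  "path P p' w \<Longrightarrow> path (P - {p}) p' w \<or>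
    (\<exists>x y. w = x @ y \<and> path P p' x \<and> foldl step p' x = p \<and>
      (y = [] \<or> (\<exists>s y'. y = s # y' \<and> s \<in> \<Sigma> \<and> path (P - {p}) (step p s) y')))"
proof (induction w arbitrary: p')
  case Nil
  then show ?case by auto
next
  case (Cons s w)
  then have s: "p' \<in> P" "s \<in> \<Sigma>" and "path P (step p' s) w" by auto
  from Cons.IH[OF this(3)] show ?case
  proof
    assume w: "path (P - {p}) (step p' s) w"
    show ?thesis
    proof (cases "p' = p")
      case True
      then show ?thesis using s w by (intro disjI2 exI[of _ "[]"] exI[of _ "s # w"]) auto
    next
      case False
      then show ?thesis using s w by auto
    qed
  next
    assume "\<exists>x y. w = x @ y \<and> path P (step p' s) x \<and> foldl step (step p' s) x = p \<and>
      (y = [] \<or> (\<exists>s y'. y = s # y' \<and> s \<in> \<Sigma> \<and> path (P - {p}) (step p s) y'))"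
    then obtain x y where "w = x @ y" "path P (step p' s) x" "foldl step (step p' s) x = p"
      "y = [] \<or> (\<exists>s y'. y = s # y' \<and> s \<in> \<Sigma> \<and> path (P - {p}) (step p s) y')" by blast
    then show ?thesis using s by (intro disjI2 exI[of _ "s # x"] exI[of _ y]) auto
  qed
qed

text \<open>The accepted words whose run never returns to \<open>p\<close>. The first letter is
  split off because the run starts in \<open>p\<close>, outside \<open>P - {p}\<close>.\<close>

definition leaving :: "'s set \<Rightarrow> 's set \<Rightarrow> 's \<Rightarrow> 'a list set" where
  "leaving F P p = (if p \<in> F then {[]} else {}) \<union> (\<Union>s\<in>\<Sigma>. (#) s ` accepted F (P - {p}) (step p s))"

lemma accepted_decomp:
  assumes "p \<in> P"
  shows "accepted F P p = {x @ y | x y. x \<in> loops P p \<and> y \<in> leaving F P p}" (is "_ = ?R")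
proof
  show "accepted F P p \<subseteq> ?R"
  proof
    fix w assume w: "w \<in> accepted F P p"
    then have "\<not> path (P - {p}) p w" using path_start by blast
    with split_at_last_visit[of P p w p] w obtain x y where xy: "w = x @ y" "path P p x" "foldl step p x = p"
      "y = [] \<or> (\<exists>s y'. y = s # y' \<and> s \<in> \<Sigma> \<and> path (P - {p}) (step p s) y')"
      unfolding accepted_def by blast
    have "y \<in> leaving F P p"
    proof (cases "y = []")
      case True
      then show ?thesis using xy w by (simp add: leaving_def accepted_def)
    next
      case False
      then obtain s y' where "y = s # y'" "s \<in> \<Sigma>" "path (P - {p}) (step p s) y'" using xy(4) by blast
      moreover from this have "y' \<in> accepted F (P - {p}) (step p s)"
        using xy w by (simp add: accepted_def)
      ultimately show ?thesis unfolding leaving_def by blast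
    qed
    then show "w \<in> ?R" using xy unfolding loops_def by blast
  qed
  show "?R \<subseteq> accepted F P p"
  proof clarify
    fix x y assume x: "x \<in> loops P p" and y: "y \<in> leaving F P p"
    have "y \<in> accepted F P p"
      using y assms path_mono[of "P - {p}" _ _ P] by (auto simp: leaving_def accepted_def split: if_splits)
    then show "x @ y \<in> accepted F P p" using x by (simp add: accepted_def loops_def path_append)
  qed
qed

text \<open>Every loop \<open>x\<close> commutes with \<open>v\<close>, since \<open>x @ v\<close>
  and \<open>v @ x\<close> are loops of equal length. So \<open>v\<close> is a prefix of each loop
  at least as long as \<open>v\<close>, and cancelling it leaves a shorter loop.\<close>

lemma loops_decomp:
  assumes unique: "\<And>x y. \<lbrakk>x \<in> loops P p; y \<in> loops P p; length x = length y\<rbrakk> \<Longrightarrow> x = y"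
    and v: "v \<in> loops P p" "v \<noteq> []"
  shows "loops P p = {concat (replicate k v) @ u | k u. u \<in> loops P p \<and> length u < length v}" (is "_ = ?R")
proof
  have "x \<in> ?R" if "x \<in> loops P p" for x
    using that
  proof (induction "length x" arbitrary: x rule: less_induct)
    case less
    show ?case
    proof (cases "length x < length v")
      case True
      then show ?thesis using less.prems by (intro CollectI exI[of _ 0] exI[of _ x]) simp
    next
      case False
      have "x @ v = v @ x" using less.prems v by (intro unique) (simp_all add: append_in_loops)
      then have "v = take (length v) x" using False
        by (metis append_eq_append_conv_if append_take_drop_id linorder_not_less)
      then obtain y where x: "x = v @ y" by (metis append_take_drop_id)
      then have y: "y \<in> loops P p" using less.prems v(1) by (simp add: append_in_loops)
      have "y \<in> ?R" using v(2) x y by (intro less.hyps) auto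
      then obtain k u where "y = concat (replicate k v) @ u" "u \<in> loops P p" "length u < length v" by blast
      then show ?thesis unfolding x by (intro CollectI exI[of _ "Suc k"] exI[of _ u]) simp
    qed
  qed
  then show "loops P p \<subseteq> ?R" by blast
  have "p \<in> P" using v(1) path_start unfolding loops_def by blast
  then have "concat (replicate k v) \<in> loops P p" for k
    using v(1) by (intro concat_in_loops) auto
  then show "?R \<subseteq> loops P p" by (auto simp: append_in_loops)
qed

text \<open>One length for all state sets and base points yields a common ratio
  \<open>d ^ D\<close>. The product of chosen loop lengths works, since repeating a loop multiplies
  its length.\<close>

lemma common_loop_length:
  assumes "finite Q"
  obtains D where "D > 0" "\<And>P p v. \<lbrakk>P \<subseteq> Q; v \<in> loops P p; v \<noteq> []\<rbrakk> \<Longrightarrow> \<exists>v\<in>loops P p. length v = D"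
proof -
  \<comment> \<open>The default 1 for pairs without a nonempty loop keeps the product
    positive.\<close>
  define l where "l = (\<lambda>(P, p). if \<exists>v\<in>loops P p. v \<noteq> [] then length (SOME v. v \<in> loops P p \<and> v \<noteq> []) else 1)"
  have l: "\<exists>v\<in>loops P p. v \<noteq> [] \<and> length v = l (P, p)" if "v \<in> loops P p" "v \<noteq> []" for P p v
  proof -
    have "(SOME v. v \<in> loops P p \<and> v \<noteq> []) \<in> loops P p \<and> (SOME v. v \<in> loops P p \<and> v \<noteq> []) \<noteq> []"
      by (rule someI[of _ v]) (use that in simp)
    then show ?thesis using that unfolding l_def by auto
  qed
  have pos: "l x > 0" for x
  proof (cases x)
    case (Pair P p)
    show ?thesis
    proof (cases "\<exists>v\<in>loops P p. v \<noteq> []")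
      case True
      then obtain v where v: "v \<in> loops P p" "v \<noteq> []" by blast
      show ?thesis using l[OF v] Pair by (metis length_greater_0_conv)
    qed (simp add: l_def Pair)
  qed
  show thesis
  proof (rule that[of "\<Prod>x\<in>Pow Q \<times> Q. l x"])
    show "(\<Prod>x\<in>Pow Q \<times> Q. l x) > 0" using pos by (simp add: prod_pos)
    fix P p v assume P: "P \<subseteq> Q" and v: "v \<in> loops P p" "v \<noteq> []"
    have p: "p \<in> P" using v(1) path_start unfolding loops_def by blast
    obtain y where y: "y \<in> loops P p" "length y = l (P, p)" using l[OF v] by blast
    have "l (P, p) dvd (\<Prod>x\<in>Pow Q \<times> Q. l x)"
      using P p assms by (intro dvd_prodI) auto
    then obtain k where k: "(\<Prod>x\<in>Pow Q \<times> Q. l x) = l (P, p) * k" by blast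
    have "concat (replicate k y) \<in> loops P p" using y p by (intro concat_in_loops) auto
    moreover have "length (concat (replicate k y)) = (\<Prod>x\<in>Pow Q \<times> Q. l x)"
      using y(2) k by (simp add: length_concat sum_list_replicate)
    ultimately show "\<exists>v\<in>loops P p. length v = (\<Prod>x\<in>Pow Q \<times> Q. l x)" by blast
  qed
qed

end

text \<open>Induction on the number of states. If \<open>p\<close> has nonempty loops, an accepted
  word is a power of a loop \<open>v\<close> of length \<open>D\<close>, then a shorter loop
  \<open>u\<close>, then a word not returning to \<open>p\<close>. Values of the last come from the
  induction hypothesis, \<open>u\<close> acts as an affine map, and \<open>v\<close> as a pump of
  ratio \<open>d ^ D\<close>.\<close>

lemma geo_union_accepted:
  fixes \<Sigma> :: "(int ^ 'm) set" and step :: "'s \<Rightarrow> int ^ 'm \<Rightarrow> 's"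
  assumes d: "d \<ge> 2" and "finite \<Sigma>" and "finite P" and "D > 0"
    and "\<And>P' p v. \<lbrakk>P' \<subseteq> P; v \<in> loops step \<Sigma> P' p; v \<noteq> []\<rbrakk> \<Longrightarrow> \<exists>v\<in>loops step \<Sigma> P' p. length v = D"
    and "\<And>p x y. \<lbrakk>accepted step \<Sigma> F P p \<noteq> {}; x \<in> loops step \<Sigma> P p; y \<in> loops step \<Sigma> P p; length x = length y\<rbrakk> \<Longrightarrow> x = y"
  shows "geo_union (d ^ D) (word_value d ` accepted step \<Sigma> F P p)"
  using assms(3,5,6)
proof (induction "card P" arbitrary: P p rule: less_induct)
  case less
  note period = less.prems(2) and unique = less.prems(3)
  let ?q = "d ^ D"
  let ?loops = "loops step \<Sigma> P p"
  let ?rest = "leaving step \<Sigma> F P p"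
  show ?case
  proof (cases "p \<in> P \<and> accepted step \<Sigma> F P p \<noteq> {}")
    case False
    then have "accepted step \<Sigma> F P p = {}" using path_start unfolding accepted_def by fast
    then show ?thesis by (simp add: geo_union_empty)
  next
    case True
    have "geo_union ?q (word_value d ` accepted step \<Sigma> F (P - {p}) p')" for p'
    proof (rule less.hyps)
      show "card (P - {p}) < card P" using True less.prems(1) by (intro psubset_card_mono) auto
      show "\<exists>v\<in>loops step \<Sigma> P' p'. length v = D"
        if "P' \<subseteq> P - {p}" "v \<in> loops step \<Sigma> P' p'" "v \<noteq> []" for P' p' v
        using period[of P' v p'] that by blast
      show "x = y" if "accepted step \<Sigma> F (P - {p}) p' \<noteq> {}" "x \<in> loops step \<Sigma> (P - {p}) p'"
        "y \<in> loops step \<Sigma> (P - {p}) p'" "length x = length y" for p' x y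
        using that unique[of p' x y] accepted_mono[of "P - {p}" P] loops_mono[of "P - {p}" P] by blast
    qed (use less.prems(1) in simp)
    then have "geo_union ?q ((\<lambda>x. s + d *s x) ` word_value d ` accepted step \<Sigma> F (P - {p}) p')" for s p'
      by (intro geo_union_affine)
    then have "geo_union ?q ((if p \<in> F then {0} else {}) \<union>
        (\<Union>s\<in>\<Sigma>. (\<lambda>x. s + d *s x) ` word_value d ` accepted step \<Sigma> F (P - {p}) (step p s)))"
      using \<open>finite \<Sigma>\<close> by (intro geo_union_Un geo_union_UN) (auto intro: geo_union_empty geo_union_singleton)
    moreover have "(if p \<in> F then {0} else {}) \<union>
        (\<Union>s\<in>\<Sigma>. (\<lambda>x. s + d *s x) ` word_value d ` accepted step \<Sigma> F (P - {p}) (step p s)) = word_value d ` ?rest"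
      unfolding leaving_def by (simp add: image_Un image_UN image_image)
    ultimately have rest: "geo_union ?q (word_value d ` ?rest)" by (simp only:)
    show ?thesis
    proof (cases "\<exists>v\<in>?loops. v \<noteq> []")
      case False
      then have "?loops = {[]}" using True Nil_in_loops[of p P] by blast
      then have "accepted step \<Sigma> F P p = ?rest" using accepted_decomp[OF conjunct1[OF True], of step \<Sigma> F] by auto
      then show ?thesis using rest by simp
    next
      case nonempty: True
      then obtain v where v: "v \<in> ?loops" "length v = D" using period[of P] by blast
      then have "v \<noteq> []" using \<open>D > 0\<close> by auto
      define U where "U = {u\<in>?loops. length u < D}"
      have "U \<subseteq> {u. set u \<subseteq> \<Sigma> \<and> length u \<le> D}"
        unfolding U_def loops_def using path_lists by fastforce
      then have "finite U" using finite_lists_length_le[OF \<open>finite \<Sigma>\<close>] by (rule finite_subset)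
      let ?f = "\<lambda>x. word_value d v + ?q *s x"
      let ?T = "\<lambda>u. (\<lambda>x. word_value d u + d ^ length u *s x) ` word_value d ` ?rest"
      have loops: "?loops = {concat (replicate k v) @ u | k u. u \<in> U}"
        using loops_decomp[OF _ v(1) \<open>v \<noteq> []\<close>] unique[of p] True v(2) unfolding U_def by auto
      have "accepted step \<Sigma> F P p = (\<Union>u\<in>U. \<Union>y\<in>?rest. range (\<lambda>k. concat (replicate k v) @ u @ y))"
      proof (intro set_eqI iffI)
        fix w assume "w \<in> accepted step \<Sigma> F P p"
        then obtain x y where w: "w = x @ y" "x \<in> ?loops" "y \<in> ?rest"
          unfolding accepted_decomp[OF conjunct1[OF True]] by blast
        then obtain k u where "x = concat (replicate k v) @ u" "u \<in> U" unfolding loops by blast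
        then have "w = concat (replicate k v) @ u @ y" using w(1) by simp
        then show "w \<in> (\<Union>u\<in>U. \<Union>y\<in>?rest. range (\<lambda>k. concat (replicate k v) @ u @ y))"
          using \<open>u \<in> U\<close> w(3) by blast
      next
        fix w assume "w \<in> (\<Union>u\<in>U. \<Union>y\<in>?rest. range (\<lambda>k. concat (replicate k v) @ u @ y))"
        then obtain u y k where "u \<in> U" "y \<in> ?rest" "w = (concat (replicate k v) @ u) @ y" by auto
        moreover from this have "concat (replicate k v) @ u \<in> ?loops" unfolding loops by blast
        ultimately show "w \<in> accepted step \<Sigma> F P p"
          unfolding accepted_decomp[OF conjunct1[OF True]] by blast
      qed
      then have "word_value d ` accepted step \<Sigma> F P p =
          (\<Union>u\<in>U. \<Union>y\<in>?rest. range (\<lambda>k. (?f ^^ k) (word_value d (u @ y))))"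
        by (simp add: image_UN image_image word_value_replicate_append v(2))
      also have "\<dots> = (\<Union>u\<in>U. \<Union>x\<in>?T u. range (\<lambda>k. (?f ^^ k) x))"
        by (simp add: word_value_append)
      also have "geo_union ?q \<dots>"
      proof (rule geo_union_UN[OF \<open>finite U\<close>])
        show "geo_union ?q (\<Union>x\<in>?T u. range (\<lambda>k. (?f ^^ k) x))" for u
          by (rule geo_union_funpow[OF _ geo_union_affine[OF rest]])
            (use d \<open>D > 0\<close> self_le_power[of d D] in linarith)
      qed
      finally show ?thesis .
    qed
  qed
qed

section \<open>Sparseness makes loops unique for their length\<close>

lemma poly_less_two_power:
  fixes p :: "real poly"
  shows "\<exists>n. poly p (real (a + n * l)) < 2 ^ n"
proof -
  \<comment> \<open>By this substitution \<open>r\<close> at \<open>n * ln 2\<close> equals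
    \<open>p\<close> at \<open>a + n * l\<close>, while \<open>exp\<close> there is
    \<open>2 ^ n\<close>.\<close>
  define r where "r = pcompose p [:real a, real l / ln 2:]"
  have "((\<lambda>x. \<Sum>i\<le>degree r. coeff r i * (x ^ i / exp x)) \<longlongrightarrow> 0) at_top"
    by (intro tendsto_null_sum tendsto_mult_right_zero tendsto_power_div_exp_0)
  then have "((\<lambda>x. poly r x / exp x) \<longlongrightarrow> 0) at_top"
    by (simp add: poly_altdef sum_divide_distrib)
  then have "eventually (\<lambda>x. poly r x / exp x < 1) at_top"
    by (rule order_tendstoD) simp
  then obtain X where X: "\<And>x. x \<ge> X \<Longrightarrow> poly r x / exp x < 1"
    unfolding eventually_at_top_linorder by blast
  obtain n where n: "X / ln 2 \<le> real n" using real_arch_simple by blast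
  have "poly r (real n * ln 2) < exp (real n * ln 2)"
    using X[of "real n * ln 2"] n by (simp add: field_simps)
  then have "poly p (real (a + n * l)) < 2 ^ n"
    by (simp add: r_def poly_pcompose exp_of_nat_mult mult.commute)
  then show ?thesis ..
qed

text \<open>Two different loops of equal length at a reachable state with an accepted continuation
  could be mixed freely. Coding bit strings by them gives \<open>2 ^ n\<close> accepted words of
  length linear in \<open>n\<close>, against the polynomial bound.\<close>

lemma sparse_loops_unique:
  assumes fin: "finite \<Sigma>"
    and sparse: "\<And>k. real (card {w \<in> lists \<Sigma>. foldl step q0 w \<in> F \<and> length w \<le> k}) \<le> poly f (real k)"
    and x: "x \<in> lists \<Sigma>" "foldl step q0 x = p" and z: "z \<in> accepted step \<Sigma> F P p"
    and y: "y1 \<in> loops step \<Sigma> P p" "y2 \<in> loops step \<Sigma> P p" "length y1 = length y2"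
  shows "y1 = y2"
proof (rule ccontr)
  assume "y1 \<noteq> y2"
  define enc where "enc = (\<lambda>bs. concat (map (\<lambda>b. if b then y1 else y2) bs))"
  have len: "length (enc bs) = length bs * length y1" for bs
    using y(3) by (induction bs) (simp_all add: enc_def)
  have inj: "bs = bs'" if "length bs = length bs'" "enc bs = enc bs'" for bs bs'
    using that
  proof (induction rule: list_induct2)
    case (Cons b bs b' bs')
    then show ?case using \<open>y1 \<noteq> y2\<close> y(3) by (auto simp: enc_def split: if_splits)
  qed simp
  have "p \<in> P" using z path_start unfolding accepted_def by fast
  then have enc: "enc bs \<in> loops step \<Sigma> P p" for bs
    unfolding enc_def using y by (intro concat_in_loops) auto
  have lists: "enc bs \<in> lists \<Sigma>" "z \<in> lists \<Sigma>" for bs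
    using enc z path_lists unfolding loops_def accepted_def by fast+
  obtain n where n: "poly f (real (length x + length z + n * length y1)) < 2 ^ n"
    using poly_less_two_power by blast
  define k where "k = length x + length z + n * length y1"
  define W where "W = {w \<in> lists \<Sigma>. foldl step q0 w \<in> F \<and> length w \<le> k}"
  define B where "B = {bs :: bool list. set bs \<subseteq> UNIV \<and> length bs = n}"
  have "finite W"
    by (rule finite_subset[OF _ finite_lists_length_le[OF fin, of k]]) (auto simp: W_def)
  moreover have "inj_on (\<lambda>bs. x @ enc bs @ z) B"
    using inj by (auto simp: inj_on_def B_def)
  moreover have "(\<lambda>bs. x @ enc bs @ z) ` B \<subseteq> W"
  proof clarify
    fix bs assume "bs \<in> B"
    moreover have "foldl step p (enc bs) = p" using enc by (auto simp: loops_def)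
    ultimately show "x @ enc bs @ z \<in> W"
      using x z lists by (auto simp: W_def B_def k_def len accepted_def)
  qed
  ultimately have "card B \<le> card W" by (intro card_inj_on_le)
  moreover have "card B = 2 ^ n" unfolding B_def by (subst card_lists_length_eq) simp_all
  ultimately have "real (2 ^ n) \<le> real (card W)" by simp
  also have "\<dots> \<le> poly f (real k)" unfolding W_def by (rule sparse)
  finally show False using n unfolding k_def by simp
qed

lemma geo_union_sparse:
  fixes A :: "(int ^ 'm) set"
  assumes "d \<ge> 2" "d_sparse d A"
  obtains D where "D > 0" "geo_union (int d ^ D) A"
proof -
  let ?\<Sigma> = "signed_alphabet d :: (int ^ 'm) set"
  have fin: "finite ?\<Sigma>" and reg: "regular_language ?\<Sigma> (vec_canonical d ` A)"
    and "\<exists>p :: real poly. \<forall>k. real (card {w \<in> vec_canonical d ` A. length w \<le> k}) \<le> poly p (real k)"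
    using assms(2) unfolding d_sparse_def sparse_language_def by blast+
  then obtain f :: "real poly" where f: "\<And>k. real (card {w \<in> vec_canonical d ` A. length w \<le> k}) \<le> poly f (real k)"
    by blast
  obtain Q :: "nat set" and q0 step F where Q: "finite Q" "q0 \<in> Q" "\<forall>q\<in>Q. \<forall>s\<in>?\<Sigma>. step q s \<in> Q"
    and L: "vec_canonical d ` A = {w \<in> lists ?\<Sigma>. foldl step q0 w \<in> F}"
    using reg unfolding regular_language_def by blast
  \<comment> \<open>Only reachable states are kept, as sparseness constrains loops only at states
    that some word reaches from \<open>q0\<close>.\<close>
  define P where "P = foldl step q0 ` lists ?\<Sigma>"
  have "foldl step q w \<in> Q" if "w \<in> lists ?\<Sigma>" "q \<in> Q" for w q
    using that by (induction w arbitrary: q) (use Q(3) in auto)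
  then have "P \<subseteq> Q" unfolding P_def using Q(2) by blast
  then have "finite P" using Q(1) finite_subset by blast
  have path: "path step ?\<Sigma> P (foldl step q0 u) w" if "u \<in> lists ?\<Sigma>" "w \<in> lists ?\<Sigma>" for u w
    using that
  proof (induction w arbitrary: u)
    case Nil
    then show ?case by (simp add: P_def)
  next
    case (Cons s w)
    then have "path step ?\<Sigma> P (foldl step q0 (u @ [s])) w" by (intro Cons.IH) auto
    then show ?case using Cons.prems by (simp add: P_def)
  qed
  have acc: "vec_canonical d ` A = accepted step ?\<Sigma> F P q0"
    unfolding L accepted_def using path[of "[]"] path_lists[of step ?\<Sigma> P q0] by auto
  obtain D where D: "D > 0" "\<And>P' p v. \<lbrakk>P' \<subseteq> P; v \<in> loops step ?\<Sigma> P' p; v \<noteq> []\<rbrakk> \<Longrightarrow>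
      \<exists>v\<in>loops step ?\<Sigma> P' p. length v = D"
    by (rule common_loop_length[OF \<open>finite P\<close>, of step ?\<Sigma>]) blast
  have "geo_union (int d ^ D) (word_value (int d) ` accepted step ?\<Sigma> F P q0)"
  proof (rule geo_union_accepted[OF _ fin \<open>finite P\<close> D])
    fix p x y assume p: "accepted step ?\<Sigma> F P p \<noteq> {}"
      and xy: "x \<in> loops step ?\<Sigma> P p" "y \<in> loops step ?\<Sigma> P p" "length x = length y"
    obtain z where z: "z \<in> accepted step ?\<Sigma> F P p" using p by blast
    then have "p \<in> P" using path_start unfolding accepted_def by fast
    then obtain u where u: "u \<in> lists ?\<Sigma>" "foldl step q0 u = p" unfolding P_def by blast
    show "x = y"
    proof (rule sparse_loops_unique[OF fin _ u z xy])
      show "real (card {w \<in> lists ?\<Sigma>. foldl step q0 w \<in> F \<and> length w \<le> k}) \<le> poly f (real k)" for k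
        using f[of k] unfolding L by simp
    qed
  qed (use assms(1) in simp)
  moreover have "word_value (int d) ` accepted step ?\<Sigma> F P q0 = A"
    unfolding acc[symmetric] image_image word_value_vec_canonical[OF assms(1)] by simp
  ultimately show thesis using that D(1) by metis
qed

theorem theorem3p1:
  fixes d :: nat and A :: "(int ^ 'm) set"
  assumes "d \<ge> 2"
    and "d_sparse d A"
    and "stable_in_group A"
  shows "A \<in> boolean_combinations (translated_C_sums d)"
proof -
  obtain \<delta> where "\<delta> > 0" "geo_union (int d ^ \<delta>) A"
    using geo_union_sparse[OF assms(1,2)] .
  define q where "q = int d ^ \<delta>"
  have q: "q \<ge> 2"
    using assms(1) \<open>\<delta> > 0\<close> self_le_power[of "int d" \<delta>] unfolding q_def by linarith
  obtain \<V> where \<V>: "finite \<V>" "\<And>V. V \<in> \<V> \<Longrightarrow> \<exists>r c a. V = descending_geo_set q r c a" "A = \<Union>\<V>"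
    using \<open>geo_union (int d ^ \<delta>) A\<close> unfolding geo_union_def q_def by metis
  have "stretchable q V" if "V \<in> \<V>" for V
    using \<V>(2)[OF that] stretchable_geo_set[OF q finite_lessThan] by auto
  \<comment> \<open>The only use of stability: it upgrades stretchability of the union to
    tameness.\<close>
  then have "tame q A"
    unfolding \<V>(3) using \<V>(1,3) assms(3) by (intro tame_if_stable stretchable_Union) auto
  \<comment> \<open>Dropping the order may lead outside \<open>A\<close>. The unordered sets are
    therefore intersected with \<open>A\<close> below, and each trace still contains its
    \<open>V\<close>.\<close>
  have sub: "\<exists>r c a. V \<subseteq> free_geo_set q {..<r :: nat} c a" if "V \<in> \<V>" for V
  proof -
    obtain r c a where "V = descending_geo_set q r c a" using \<V>(2) \<open>V \<in> \<V>\<close> by blast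
    then have "V \<subseteq> free_geo_set q {..<r} c a" unfolding geo_set_def by blast
    then show ?thesis by blast
  qed
  have part: "A \<inter> free_geo_set q {..<r} c a \<in> boolean_combinations (translated_C_sums d)" for r c a
    by (rule tame_subset_free_geo_set[OF q_def q \<open>\<delta> > 0\<close> finite_lessThan
        tame_Int[OF \<open>tame q A\<close> tame_free_geo_set[OF q finite_lessThan]] Int_lower2])
  have "\<forall>V\<in>\<V>. \<exists>X. X \<in> boolean_combinations (translated_C_sums d) \<and> V \<subseteq> X \<and> X \<subseteq> A"
    using sub part \<V>(3) by (meson Int_greatest Int_lower1 Union_upper)
  from bchoice[OF this] obtain X where
    X: "\<And>V. V \<in> \<V> \<Longrightarrow> X V \<in> boolean_combinations (translated_C_sums d) \<and> V \<subseteq> X V \<and> X V \<subseteq> A"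
    by blast
  have "\<Union>(X ` \<V>) \<in> boolean_combinations (translated_C_sums d)"
    using X \<V>(1) by (intro boolean_combinations_Union[OF part]) auto
  moreover have "\<Union>(X ` \<V>) = A"
    using X \<V>(3) by blast
  ultimately show ?thesis by simp
qed

end
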